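(* Let $n\ge 2$ and $F=(x_1^2+x_2^2)(y_1^2+\cdots+y_n^2)\in\mathbb{C}[x_1,x_2,y_1,\ldots,y_n]$. Then the cactus rank and the border rank of $F$ satisfy $$\operatorname{cr}F=2n+4\qquad\text{and}\qquad 2n+2\le\operatorname{brk}F\le 2n+4.$$
   Context: Let $T=\mathbb{C}[X_1,X_2,Y_1,\ldots,Y_n]$ act on $S=\mathbb{C}[x_1,x_2,y_1,\ldots,y_n]$ by differentiation ($X_i=\partial/\partial x_i$, $Y_j=\partial/\partial y_j$), and for a form $F\in S$ let $F^\perp=\{g\in T:g\circ F=0\}$. $T$ is also the homogeneous coordinate ring of $\mathbb{P}^{n+1}$. The cactus rank $\operatorname{cr}F$ is the minimum length of a zero-dimensional closed subscheme $\mathbb{X}\subset\mathbb{P}^{n+1}$ whose saturated homogeneous ideal satisfies $I(\mathbb{X})\subseteq F^\perp$. The Waring rank of a form $G$ of degree $d$ is the least $r$ such that $G=\sum_{i=1}^r\alpha_iL_i^d$ with $\alpha_i\in\mathbb{C}$, $L_i$ linear forms. The border rank $\operatorname{brk}F$ is the smallest $r$ such that $F$ is a limit of forms of Waring rank $r$. *)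

theory Defs
  imports "HOL-Analysis.Analysis" "HOL-Library.Poly_Mapping" "HOL-Library.Extended_Nat"
begin

section \<open>Complex polynomials in finitely many variables\<close>

text \<open>
  The type \<open>'v mpoly\<close>, for finite \<open>'v\<close>, is the polynomial ring over the complex numbers with one
  variable for each element of \<open>'v\<close>; its ring structure is the convolution structure of the
  finitely supported functions. It plays the role both of \<open>S\<close> and of \<open>T\<close>; for the latter
  the variable \<open>v\<close> is read as the derivation by \<open>v\<close>.
\<close>

type_synonym 'v monom = "'v \<Rightarrow>\<^sub>0 nat"
type_synonym 'v mpoly = "'v monom \<Rightarrow>\<^sub>0 complex"

definition Var :: "'v \<Rightarrow> 'v mpoly" where
  "Var v = Poly_Mapping.single (Poly_Mapping.single v 1) 1"

definition smul :: "complex \<Rightarrow> 'v mpoly \<Rightarrow> 'v mpoly" where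
  "smul c p = Poly_Mapping.single 0 c * p"

lemma lookup_smul: "Poly_Mapping.lookup (smul c p) m = c * Poly_Mapping.lookup p m"
proof -
  have "smul c p = Poly_Mapping.map ((*) c) p"
    by (simp add: smul_def mult_map_scale_conv_mult)
  thus ?thesis by (simp add: Poly_Mapping.map.rep_eq when_def)
qed

global_interpretation mpoly: vector_space "smul :: complex \<Rightarrow> 'v mpoly \<Rightarrow> 'v mpoly"
  by unfold_locales
    (rule poly_mapping_eqI, simp add: lookup_smul lookup_add algebra_simps)+

definition mdeg :: "'v::finite monom \<Rightarrow> nat" where
  "mdeg m = (\<Sum>v\<in>UNIV. Poly_Mapping.lookup m v)"

definition is_form :: "nat \<Rightarrow> 'v::finite mpoly \<Rightarrow> bool" where
  "is_form d p \<longleftrightarrow> (\<forall>m\<in>Poly_Mapping.keys p. mdeg m = d)"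

definition hom_part :: "nat \<Rightarrow> 'v::finite mpoly \<Rightarrow> 'v mpoly" where
  "hom_part d p = (\<Sum>m | m \<in> Poly_Mapping.keys p \<and> mdeg m = d.
                     Poly_Mapping.single m (Poly_Mapping.lookup p m))"


section \<open>The action by differentiation\<close>

text \<open>If \<open>v\<close> does not occur in \<open>m\<close>, the truncated difference below is harmless: the coefficient
  is zero.\<close>

definition pdiff :: "'v \<Rightarrow> 'v mpoly \<Rightarrow> 'v mpoly" where
  "pdiff v p = (\<Sum>m\<in>Poly_Mapping.keys p.
     Poly_Mapping.single (m - Poly_Mapping.single v 1)
       (of_nat (Poly_Mapping.lookup m v) * Poly_Mapping.lookup p m))"

definition mono_diff :: "'v::finite monom \<Rightarrow> 'v mpoly \<Rightarrow> 'v mpoly" where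
  "mono_diff a p = Finite_Set.fold (\<lambda>v. pdiff v ^^ Poly_Mapping.lookup a v) p UNIV"

definition diff_act :: "'v::finite mpoly \<Rightarrow> 'v mpoly \<Rightarrow> 'v mpoly" (infixr "\<odot>" 72) where
  "g \<odot> p = (\<Sum>a\<in>Poly_Mapping.keys g. smul (Poly_Mapping.lookup g a) (mono_diff a p))"

lemma lookup_pdiff:
  "Poly_Mapping.lookup (pdiff v p) m =
     of_nat (Poly_Mapping.lookup m v + 1) * Poly_Mapping.lookup p (m + Poly_Mapping.single v 1)"
proof -
  let ?e = "Poly_Mapping.single v (1::nat)"
  have eq: "Poly_Mapping.lookup (Poly_Mapping.single (b - ?e)
              (of_nat (Poly_Mapping.lookup b v) * Poly_Mapping.lookup p b)) m
          = (if b = m + ?e then of_nat (Poly_Mapping.lookup m v + 1) * Poly_Mapping.lookup p b else 0)"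
    for b
  proof (cases "b = m + ?e")
    case True
    thus ?thesis by (simp add: lookup_add)
  next
    case False
    have "Poly_Mapping.lookup b v = 0" if "b - ?e = m"
    proof (rule ccontr)
      assume "Poly_Mapping.lookup b v \<noteq> 0"
      hence "b = (b - ?e) + ?e"
        by (intro poly_mapping_eqI) (auto simp: lookup_add lookup_minus lookup_single when_def)
      with that False show False by simp
    qed
    with False show ?thesis by (auto simp: lookup_single when_def)
  qed
  show ?thesis
    unfolding pdiff_def lookup_sum eq
    by (auto simp: sum.delta in_keys_iff simp del: of_nat_add)
qed

text \<open>Partial derivatives commute, so the order in which the fold in \<open>mono_diff\<close> composes
  them is irrelevant.\<close>

lemma pdiff_commute: "pdiff v (pdiff w p) = pdiff w (pdiff v p)"
  by (cases "v = w", simp, intro poly_mapping_eqI)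
    (simp add: lookup_pdiff lookup_add lookup_single when_def ac_simps)

lemma comp_fun_commute_pdiff:
  "comp_fun_commute (\<lambda>v. pdiff v ^^ Poly_Mapping.lookup a v)"
proof
  fix v w :: 'a
  have 1: "(pdiff w ^^ j) (pdiff v x) = pdiff v ((pdiff w ^^ j) x)" for j x
    by (induction j) (auto simp: pdiff_commute)
  have "(pdiff w ^^ j) ((pdiff v ^^ i) x) = (pdiff v ^^ i) ((pdiff w ^^ j) x)" for i j x
    by (induction i) (auto simp: 1)
  thus "(pdiff w ^^ Poly_Mapping.lookup a w) \<circ> (pdiff v ^^ Poly_Mapping.lookup a v)
      = (pdiff v ^^ Poly_Mapping.lookup a v) \<circ> (pdiff w ^^ Poly_Mapping.lookup a w)"
    by (auto simp: fun_eq_iff)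
qed

definition perp :: "'v::finite mpoly \<Rightarrow> 'v mpoly set" where
  "perp F = {g. g \<odot> F = 0}"


section \<open>Closed subschemes of projective space and cactus rank\<close>

definition is_ideal :: "'a::comm_ring_1 set \<Rightarrow> bool" where
  "is_ideal I \<longleftrightarrow> 0 \<in> I \<and> (\<forall>a\<in>I. \<forall>b\<in>I. a + b \<in> I) \<and> (\<forall>a\<in>I. \<forall>c. c * a \<in> I)"

definition homogeneous_ideal :: "'v::finite mpoly set \<Rightarrow> bool" where
  "homogeneous_ideal I \<longleftrightarrow> is_ideal I \<and> (\<forall>p\<in>I. \<forall>d. hom_part d p \<in> I)"

text \<open>Saturation is with respect to the irrelevant ideal, whose \<open>k\<close>-th power is generated by
  the forms of degree \<open>k\<close>.\<close>

definition saturated :: "'v::finite mpoly set \<Rightarrow> bool" where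
  "saturated I \<longleftrightarrow> (\<forall>p. (\<exists>k. \<forall>g. is_form k g \<longrightarrow> g * p \<in> I) \<longrightarrow> p \<in> I)"

text \<open>For homogeneous \<open>I\<close> this is the dimension of the degree-\<open>d\<close> part of the quotient by \<open>I\<close>;
  both spaces below are finite-dimensional because there are finitely many variables.\<close>

definition hilbert_function :: "'v::finite mpoly set \<Rightarrow> nat \<Rightarrow> nat" where
  "hilbert_function I d = mpoly.dim {p :: 'v mpoly. is_form d p} - mpoly.dim {p \<in> I. is_form d p}"

text \<open>
  Closed subschemes of the projective space with homogeneous coordinate ring \<open>'v mpoly\<close> correspond
  bijectively to saturated homogeneous ideals, and are represented by them. Such a subscheme is
  zero-dimensional of length \<open>r\<close> iff its Hilbert polynomial is the nonzero constant \<open>r\<close>,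
  that is, iff its Hilbert function is eventually equal to \<open>r > 0\<close>.
\<close>

definition zero_dim_subscheme :: "'v::finite mpoly set \<Rightarrow> nat \<Rightarrow> bool" where
  "zero_dim_subscheme I r \<longleftrightarrow>
     homogeneous_ideal I \<and> saturated I \<and>
     r > 0 \<and> eventually (\<lambda>d. hilbert_function I d = r) sequentially"

text \<open>Ranks are valued in \<open>enat\<close>, where every nonempty set has a minimum, namely its infimum;
  the infimum of the empty set is infinity.\<close>

definition cactus_rank :: "'v::finite mpoly \<Rightarrow> enat" where
  "cactus_rank F = Inf {enat r | r. \<exists>I. zero_dim_subscheme I r \<and> I \<subseteq> perp F}"


section \<open>Waring rank and border rank\<close>

text \<open>The degree \<open>d\<close> is an explicit parameter because the zero form has no well-defined degree.\<close>

definition waring_rank :: "nat \<Rightarrow> 'v::finite mpoly \<Rightarrow> enat" where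
  "waring_rank d G = Inf {enat r | r. \<exists>\<alpha> L. (\<forall>i<r. is_form 1 (L i)) \<and>
                                             G = (\<Sum>i<r. smul (\<alpha> i) (L i ^ d))}"

text \<open>The forms of degree \<open>d\<close> are a finite-dimensional vector space, so convergence in it is
  convergence of each coefficient.\<close>

definition form_tendsto :: "(nat \<Rightarrow> 'v mpoly) \<Rightarrow> 'v mpoly \<Rightarrow> bool" where
  "form_tendsto G F \<longleftrightarrow>
     (\<forall>m. (\<lambda>k. Poly_Mapping.lookup (G k) m) \<longlonglongrightarrow> Poly_Mapping.lookup F m)"

definition border_rank :: "nat \<Rightarrow> 'v::finite mpoly \<Rightarrow> enat" where
  "border_rank d F = Inf {enat r | r. \<exists>G. (\<forall>k. is_form d (G k) \<and> waring_rank d (G k) = enat r) \<and>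
                                          form_tendsto G F}"


section \<open>The variables\<close>

datatype 'n xy_var = X1 | X2 | Y 'n

instance xy_var :: (finite) finite
proof
  have "(UNIV :: 'a xy_var set) \<subseteq> {X1, X2} \<union> Y ` UNIV"
    by (auto intro: xy_var.exhaust)
  moreover have "finite ({X1, X2} \<union> Y ` (UNIV :: 'a set))" by simp
  ultimately show "finite (UNIV :: 'a xy_var set)" by (rule finite_subset)
qed

end

theory Submission
  imports Defs
begin

text \<open>
  Over the complex numbers \<open>F = u v p\<close>, where \<open>u = x1 + i x2\<close>, \<open>v = x1 - i x2\<close> and
  \<open>p = y_1^2 + ... + y_n^2\<close>. Multiplying each coefficient by the factorials of its exponents turns
  differentiation into contraction, so the apolar ideal of a form is the set of all \<open>g\<close> all of whose
  multiples are killed by one linear functional on polynomials (\<open>perp_eq_apolar_ideal\<close>). With this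
  description every step below is linear algebra on coefficients.

  Cactus rank, upper bound. Setting \<open>u = 1\<close> turns \<open>F\<close> into \<open>v p\<close>, whose derivatives of all orders span
  a space of dimension \<open>2 (n + 2)\<close>: it has the basis \<open>1, y_j, p\<close> times \<open>1, v\<close>. The local scheme with
  this dual space has length \<open>2 n + 4\<close>, is supported at the point where all dual variables but the one
  of \<open>u\<close> vanish, and its ideal consists of the operators that kill \<open>u^k v p\<close> for every \<open>k\<close>. That ideal
  is \<open>graded_apolar_ideal socle_functional\<close>. It is saturated since differentiation along \<open>u\<close> lowers \<open>k\<close>
  by one, and \<open>hilbert_function_socle_ideal\<close> computes its Hilbert function from a pair of dual bases.

  Cactus rank, lower bound. This is the argument of Ranestad and Schreyer. Let \<open>I\<close> be saturated,
  homogeneous and contained in the apolar ideal of \<open>F\<close>. That ideal contains quadrics without a common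
  zero, so some combination \<open>g\<close> of them is a nonzerodivisor modulo \<open>I\<close>. In degree 3 the multiples
  of \<open>g\<close> by linear forms are apolar to \<open>F\<close> and contribute \<open>n + 2\<close> dimensions modulo \<open>I\<close>, while the cubics
  modulo the apolar ideal of \<open>F\<close> contribute another \<open>n + 2\<close>. A linear nonzerodivisor makes the Hilbert
  function of \<open>I\<close> nondecreasing, so the length is at least its value at 3, which is at least \<open>2 n + 4\<close>.
  Nonzerodivisors are found without primary decomposition (\<open>exists_nonzerodivisor\<close>): the torsion
  modules of the members of a pencil are independent modulo their common part, and there are uncountably
  many members but only countably many dimensions.

  Border rank, lower bound. The catalecticant matrix of a sum of \<open>r\<close> fourth powers has rank at most \<open>r\<close>,
  so a minor of size \<open>2 n + 2\<close> vanishes on all forms of Waring rank less than \<open>2 n + 2\<close> and, being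
  continuous, on their limits. For \<open>F\<close> there is such a minor that is 4 times a permutation matrix.

  Border rank, upper bound. The form \<open>6 u^2 p\<close> is the limit as \<open>t\<close> tends to 0 of
    \<open>H(u) = (SUM j. (u + t y_j)^4) / t^2 - (u + t^2 (y_1 + ... + y_n))^4 / t^3 + (1 / t^3 - n / t^2) u^4\<close>,
  where the last two summands cancel the terms of order 0 and 1 of the second difference quotients in
  the directions \<open>y_j\<close> at the cost of only two powers. The difference quotient \<open>(H(u + t v) - H(u)) / t\<close>
  uses \<open>2 (n + 2)\<close> fourth powers and tends to \<open>12 u v p\<close>; \<open>smoothing_identity\<close> is the exact expansion.
\<close>

section \<open>Apolarity through functionals on the coefficients\<close>

text \<open>
  The general linear functional on polynomials: it takes the value \<open>f m\<close> on the monomial \<open>m\<close>.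
\<close>

definition weighted_sum :: "('v monom \<Rightarrow> complex) \<Rightarrow> 'v mpoly \<Rightarrow> complex" where
  "weighted_sum f p = (\<Sum>m\<in>Poly_Mapping.keys p. f m * Poly_Mapping.lookup p m)"

lemma weighted_sum_superset:
  assumes "finite A" "Poly_Mapping.keys p \<subseteq> A"
  shows "weighted_sum f p = (\<Sum>m\<in>A. f m * Poly_Mapping.lookup p m)"
  unfolding weighted_sum_def using assms
  by (intro sum.mono_neutral_left) (auto simp: in_keys_iff)

lemma weighted_sum_0 [simp]: "weighted_sum f 0 = 0"
  by (simp add: weighted_sum_def)

lemma weighted_sum_add: "weighted_sum f (p + q) = weighted_sum f p + weighted_sum f q"
proof -
  let ?A = "Poly_Mapping.keys p \<union> Poly_Mapping.keys q"
  have "weighted_sum f (p + q) = (\<Sum>m\<in>?A. f m * Poly_Mapping.lookup (p + q) m)"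
    by (intro weighted_sum_superset) (auto simp: keys_add)
  also have "\<dots> = (\<Sum>m\<in>?A. f m * Poly_Mapping.lookup p m) + (\<Sum>m\<in>?A. f m * Poly_Mapping.lookup q m)"
    by (simp add: lookup_add algebra_simps sum.distrib)
  also have "\<dots> = weighted_sum f p + weighted_sum f q"
    by (simp add: weighted_sum_superset[of ?A])
  finally show ?thesis .
qed

lemma weighted_sum_single: "weighted_sum f (Poly_Mapping.single m c) = f m * c"
  by (auto simp: weighted_sum_def)

lemma weighted_sum_smul: "weighted_sum f (smul c p) = c * weighted_sum f p"
proof -
  have "weighted_sum f (smul c p) = (\<Sum>m\<in>Poly_Mapping.keys p. f m * Poly_Mapping.lookup (smul c p) m)"
    by (intro weighted_sum_superset) (auto simp: in_keys_iff lookup_smul)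
  thus ?thesis by (simp add: weighted_sum_def lookup_smul sum_distrib_left algebra_simps)
qed

lemma weighted_sum_sum: "weighted_sum f (\<Sum>i\<in>A. p i) = (\<Sum>i\<in>A. weighted_sum f (p i))"
  by (induction A rule: infinite_finite_induct) (auto simp: weighted_sum_add)

lemma weighted_sum_lincomb:
  "weighted_sum (\<lambda>m. c * f m + d * g m) p = c * weighted_sum f p + d * weighted_sum g p"
  by (simp add: weighted_sum_def sum_distrib_left algebra_simps sum.distrib)

lemma mpoly_eq_sum_single:
  "p = (\<Sum>m\<in>Poly_Mapping.keys p. Poly_Mapping.single m (Poly_Mapping.lookup p m))"
  by (rule poly_mapping_eqI) (auto simp: lookup_sum lookup_single when_def sum.delta in_keys_iff)

lemma weighted_sum_single_mult:
  "weighted_sum f (Poly_Mapping.single a c * p) = c * weighted_sum (\<lambda>m. f (a + m)) p"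
proof -
  have "weighted_sum f (Poly_Mapping.single a c * p) =
      weighted_sum f (\<Sum>m\<in>Poly_Mapping.keys p. Poly_Mapping.single (a + m) (c * Poly_Mapping.lookup p m))"
    by (subst (2) mpoly_eq_sum_single) (simp add: sum_distrib_left mult_single)
  also have "\<dots> = c * weighted_sum (\<lambda>m. f (a + m)) p"
    by (simp add: weighted_sum_sum weighted_sum_single)
      (simp add: weighted_sum_def sum_distrib_left algebra_simps)
  finally show ?thesis .
qed

lemma weighted_sum_mult:
  "weighted_sum f (h * g) = weighted_sum (\<lambda>a. weighted_sum (\<lambda>b. f (a + b)) g) h"
proof -
  have "weighted_sum f (h * g) =
      weighted_sum f (\<Sum>m\<in>Poly_Mapping.keys h. Poly_Mapping.single m (Poly_Mapping.lookup h m) * g)"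
    by (subst (1) mpoly_eq_sum_single[of h]) (simp add: sum_distrib_right)
  also have "\<dots> = weighted_sum (\<lambda>a. weighted_sum (\<lambda>b. f (a + b)) g) h"
    by (simp add: weighted_sum_sum weighted_sum_single_mult)
      (simp add: weighted_sum_def algebra_simps)
  finally show ?thesis .
qed

text \<open>
  The largest ideal in the kernel of the functional \<open>weighted_sum f\<close>; membership is tested on the
  multiples by monomials.
\<close>

definition apolar_ideal :: "('v monom \<Rightarrow> complex) \<Rightarrow> 'v mpoly set" where
  "apolar_ideal f = {g. \<forall>m. weighted_sum (\<lambda>a. f (m + a)) g = 0}"

lemma apolar_idealD: "g \<in> apolar_ideal f \<Longrightarrow> weighted_sum f (h * g) = 0"
  by (simp add: apolar_ideal_def weighted_sum_mult) (simp add: weighted_sum_def)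

lemma apolar_ideal_iff: "g \<in> apolar_ideal f \<longleftrightarrow> (\<forall>h. weighted_sum f (h * g) = 0)"
proof
  assume *: "\<forall>h. weighted_sum f (h * g) = 0"
  show "g \<in> apolar_ideal f"
    unfolding apolar_ideal_def
  proof safe
    fix m
    show "weighted_sum (\<lambda>a. f (m + a)) g = 0"
      using *[rule_format, of "Poly_Mapping.single m 1"] by (simp add: weighted_sum_single_mult)
  qed
qed (simp add: apolar_idealD)

lemma is_ideal_apolar_ideal: "is_ideal (apolar_ideal f)"
  unfolding is_ideal_def
proof (intro conjI ballI allI)
  show "0 \<in> apolar_ideal f"
    by (simp add: apolar_ideal_iff)
  show "a + b \<in> apolar_ideal f" if "a \<in> apolar_ideal f" "b \<in> apolar_ideal f" for a b
    using that by (simp add: apolar_ideal_iff weighted_sum_add ring_distribs)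
  show "c * a \<in> apolar_ideal f" if "a \<in> apolar_ideal f" for a c
    using that unfolding apolar_ideal_iff by (metis mult.assoc)
qed

definition mfact :: "'v::finite monom \<Rightarrow> complex" where
  "mfact m = (\<Prod>v\<in>UNIV. fact (Poly_Mapping.lookup m v))"

text \<open>
  The coefficient with respect to the divided power monomials. Differentiation acts on these
  coefficients by a mere shift of the exponent.
\<close>

definition dp_coeff :: "'v::finite mpoly \<Rightarrow> 'v monom \<Rightarrow> complex" where
  "dp_coeff p m = mfact m * Poly_Mapping.lookup p m"

lemma mfact_nonzero [simp]: "mfact m \<noteq> 0"
  by (simp add: mfact_def)

lemma mfact_add_single:
  "mfact (m + Poly_Mapping.single v 1) = of_nat (Poly_Mapping.lookup m v + 1) * mfact m"
proof -
  have "mfact (m + Poly_Mapping.single v 1) =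
      fact (Poly_Mapping.lookup m v + 1) * (\<Prod>w\<in>UNIV-{v}. fact (Poly_Mapping.lookup m w))"
    unfolding mfact_def
    by (subst prod.remove[of _ v]) (auto simp: lookup_add lookup_single when_def intro!: prod.cong)
  also have "\<dots> = of_nat (Poly_Mapping.lookup m v + 1) *
      (fact (Poly_Mapping.lookup m v) * (\<Prod>w\<in>UNIV-{v}. fact (Poly_Mapping.lookup m w)))"
    by (simp add: algebra_simps)
  also have "(fact (Poly_Mapping.lookup m v) * (\<Prod>w\<in>UNIV-{v}. fact (Poly_Mapping.lookup m w))) = mfact m"
    unfolding mfact_def by (subst (2) prod.remove[of _ v]) auto
  finally show ?thesis .
qed

lemma dp_coeff_pdiff: "dp_coeff (pdiff v p) m = dp_coeff p (m + Poly_Mapping.single v 1)"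
  unfolding dp_coeff_def lookup_pdiff mfact_add_single by (simp only: mult_ac)

lemma dp_coeff_pdiff_power:
  "dp_coeff ((pdiff v ^^ k) p) m = dp_coeff p (m + Poly_Mapping.single v k)"
proof (induction k arbitrary: m)
  case (Suc k)
  show ?case
    by (simp add: dp_coeff_pdiff Suc.IH add.assoc flip: single_add) 
qed simp

lemma monom_eq_sum_single:
  fixes a :: "'v::finite monom"
  shows "a = (\<Sum>v\<in>UNIV. Poly_Mapping.single v (Poly_Mapping.lookup a v))"
  by (rule poly_mapping_eqI) (auto simp: lookup_sum lookup_single when_def sum.delta)

lemma dp_coeff_mono_diff: "dp_coeff (mono_diff a p) m = dp_coeff p (m + a)"
proof -
  interpret comp_fun_commute "\<lambda>v. pdiff v ^^ Poly_Mapping.lookup a v"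
    by (rule comp_fun_commute_pdiff)
  have "dp_coeff (Finite_Set.fold (\<lambda>v. pdiff v ^^ Poly_Mapping.lookup a v) p A) m =
      dp_coeff p (m + (\<Sum>v\<in>A. Poly_Mapping.single v (Poly_Mapping.lookup a v)))" if "finite A" for A
    using that
    by (induction A arbitrary: m rule: finite_induct)
      (simp_all add: fold_insert dp_coeff_pdiff_power add.assoc)
  thus ?thesis
    unfolding mono_diff_def by (subst (2) monom_eq_sum_single) simp
qed

text \<open>
  Since a derivation shifts the divided power coefficients, the coefficients of \<open>g \<odot> p\<close> are the values at
  \<open>g\<close> of shifted functionals. At \<open>m = 0\<close> this is the apolarity pairing of \<open>g\<close> and \<open>p\<close>.
\<close>

lemma dp_coeff_diff_act: "dp_coeff (g \<odot> p) m = weighted_sum (\<lambda>a. dp_coeff p (m + a)) g"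
proof -
  have "dp_coeff (g \<odot> p) m = (\<Sum>a\<in>Poly_Mapping.keys g. Poly_Mapping.lookup g a * dp_coeff (mono_diff a p) m)"
    by (simp add: diff_act_def dp_coeff_def lookup_sum lookup_smul sum_distrib_left algebra_simps)
  thus ?thesis by (simp add: dp_coeff_mono_diff weighted_sum_def algebra_simps)
qed

lemma perp_eq_apolar_ideal: "perp p = apolar_ideal (dp_coeff p)"
proof -
  have "g \<odot> p = 0 \<longleftrightarrow> (\<forall>m. dp_coeff (g \<odot> p) m = 0)" for g
    by (auto simp: dp_coeff_def intro: poly_mapping_eqI)
  thus ?thesis by (auto simp: perp_def apolar_ideal_def dp_coeff_diff_act)
qed

section \<open>Forms and ideals of the polynomial ring\<close>

lemma monom_diff_add_single:
  "k \<le> Poly_Mapping.lookup m v \<Longrightarrow> m - Poly_Mapping.single v k + Poly_Mapping.single v k = (m :: 'v monom)"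
  by (intro poly_mapping_eqI) (auto simp: lookup_add lookup_minus lookup_single when_def)

lemma mdeg_add: "mdeg (a + b) = mdeg a + mdeg b"
  by (simp add: mdeg_def lookup_add sum.distrib)

lemma mdeg_single: "mdeg (Poly_Mapping.single v k) = k"
  by (simp add: mdeg_def lookup_single when_def)

lemma mdeg_0 [simp]: "mdeg 0 = 0"
  by (simp add: mdeg_def)

lemma is_form_0 [simp]: "is_form d 0"
  by (simp add: is_form_def)

lemma is_form_add: "is_form d p \<Longrightarrow> is_form d q \<Longrightarrow> is_form d (p + q)"
  unfolding is_form_def using keys_add[of p q] by blast

lemma is_form_smul: "is_form d p \<Longrightarrow> is_form d (smul c p)"
  by (auto simp: is_form_def in_keys_iff lookup_smul)

lemma is_form_sum: "(\<And>i. i \<in> A \<Longrightarrow> is_form d (p i)) \<Longrightarrow> is_form d (\<Sum>i\<in>A. p i)"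
  by (induction A rule: infinite_finite_induct) (auto intro: is_form_add)

lemma is_form_mult: 
  assumes "is_form d p" "is_form e q" shows "is_form (d + e) (p * q)"
  using assms keys_mult[of p q] unfolding is_form_def by (fastforce simp: mdeg_add)

lemma is_form_single: "mdeg m = d \<Longrightarrow> is_form d (Poly_Mapping.single m c)"
  by (auto simp: is_form_def)

lemma is_form_Var: "is_form 1 (Var v)"
  unfolding Var_def by (rule is_form_single) (simp add: mdeg_single)

lemma is_form_power: "is_form d p \<Longrightarrow> is_form (k * d) (p ^ k)"
proof (induction k)
  case 0
  show ?case by (simp add: is_form_def)
qed (auto intro: is_form_mult)

lemma is_form_uminus: "is_form d p \<Longrightarrow> is_form d (- p)"
  by (simp add: is_form_def)

lemma is_form_diff: "is_form d p \<Longrightarrow> is_form d q \<Longrightarrow> is_form d (p - q)"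
  using is_form_add[OF _ is_form_uminus, of d p q] by simp

lemma subspace_forms: "mpoly.subspace {p. is_form d p}"
  by (auto simp: mpoly.subspace_def is_form_add is_form_smul)

lemma is_ideal_uminus: "is_ideal I \<Longrightarrow> a \<in> I \<Longrightarrow> - a \<in> I"
  unfolding is_ideal_def by (metis mult_minus1)

lemma is_ideal_mult: "is_ideal I \<Longrightarrow> a \<in> I \<Longrightarrow> c * a \<in> I"
  by (simp add: is_ideal_def)

lemma is_ideal_sum: "is_ideal I \<Longrightarrow> (\<And>i. i \<in> A \<Longrightarrow> p i \<in> I) \<Longrightarrow> (\<Sum>i\<in>A. p i) \<in> I"
  by (induction A rule: infinite_finite_induct) (auto simp: is_ideal_def)

lemma smul_mult: "smul c p * q = smul c (p * q)" "p * smul c q = smul c (p * q)"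
  by (simp_all add: smul_def algebra_simps)

lemma is_ideal_smul: "is_ideal I \<Longrightarrow> a \<in> I \<Longrightarrow> smul c a \<in> I"
  unfolding smul_def by (rule is_ideal_mult)

lemma subspace_ideal: "is_ideal I \<Longrightarrow> mpoly.subspace I"
  by (auto simp: mpoly.subspace_def is_ideal_smul) (auto simp: is_ideal_def)

section \<open>Dimension counts for the Hilbert function\<close>

text \<open>
  Adding the vectors \<open>e j\<close> one at a time keeps a basis of the subspace independent, because a relation
  expressing one of them through the others and the basis would be a relation modulo the subspace.
\<close>

lemma (in vector_space) independent_extend:
  assumes "finite J" "independent B" "finite B"
    and indep: "\<And>c. (\<Sum>j\<in>J. scale (c j) (e j)) \<in> span B \<Longrightarrow> \<forall>j\<in>J. c j = 0"
  shows "independent (B \<union> e ` J) \<and> card (B \<union> e ` J) = card B + card J"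
  using assms(1) indep
proof (induction J rule: finite_induct)
  case empty
  thus ?case using assms by simp
next
  case (insert j J)
  have IH: "independent (B \<union> e ` J) \<and> card (B \<union> e ` J) = card B + card J"
  proof (rule insert.IH)
    fix c assume *: "(\<Sum>j\<in>J. scale (c j) (e j)) \<in> span B"
    have "(\<Sum>i\<in>insert j J. scale (if i = j then 0 else c i) (e i)) = (\<Sum>i\<in>J. scale (c i) (e i))"
      using insert.hyps by (simp, intro sum.cong) auto
    with * insert.prems[of "\<lambda>i. if i = j then 0 else c i"]
    have "\<forall>k\<in>insert j J. (if k = j then 0 else c k) = 0" by simp
    thus "\<forall>j\<in>J. c j = 0"
      using insert.hyps(2) by (metis insertCI)
  qed
  have "e j \<notin> span (B \<union> e ` J)"
  proof
    assume "e j \<in> span (B \<union> e ` J)"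
    then obtain x y where xy: "e j = x + y" "x \<in> span B" "y \<in> span (e ` J)"
      by (auto simp: span_Un)
    have "span (e ` J) \<subseteq> {y. \<exists>c. y = (\<Sum>i\<in>J. scale (c i) (e i))}"
    proof (rule span_minimal)
      show "e ` J \<subseteq> {y. \<exists>c. y = (\<Sum>i\<in>J. scale (c i) (e i))}"
      proof safe
        fix i assume "i \<in> J"
        thus "\<exists>c. e i = (\<Sum>i\<in>J. scale (c i) (e i))"
          using insert.hyps by (intro exI[of _ "\<lambda>k. if k = i then 1 else 0"])
            (simp add: if_distrib[of "\<lambda>c. scale c _"] sum.delta cong: if_cong)
      qed
      show "subspace {y. \<exists>c. y = (\<Sum>i\<in>J. scale (c i) (e i))}"
        unfolding subspace_def
      proof (safe, goal_cases)
        case 1 show ?case by (intro exI[of _ "\<lambda>_. 0"]) simp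
      next
        case (2 x y c d) show ?case
          by (intro exI[of _ "\<lambda>i. c i + d i"]) (simp add: scale_left_distrib sum.distrib)
      next
        case (3 a x c) show ?case
          by (intro exI[of _ "\<lambda>i. a * c i"]) (simp add: scale_sum_right)
      qed
    qed
    with xy obtain c where c: "y = (\<Sum>i\<in>J. scale (c i) (e i))" by blast
    \<comment> \<open>This is the forbidden relation: \<open>e j\<close> minus its expression through the other vectors.\<close>
    let ?d = "\<lambda>i. if i = j then 1 else - c i"
    have "(\<Sum>i\<in>J. scale (?d i) (e i)) = - y"
      unfolding c sum_negf[symmetric] using insert.hyps by (intro sum.cong) auto
    hence "(\<Sum>i\<in>insert j J. scale (?d i) (e i)) = x"
      using insert.hyps xy(1) by simp
    hence "(\<Sum>i\<in>insert j J. scale (?d i) (e i)) \<in> span B"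
      using xy(2) by (simp only:)
    hence "\<forall>i\<in>insert j J. ?d i = 0"
      by (rule insert.prems[of ?d])
    hence "?d j = 0"
      by (rule bspec) (rule insertI1)
    thus False by simp
  qed
  moreover from this have "e j \<notin> B \<union> e ` J"
    using span_base[of "e j" "B \<union> e ` J"] by blast
  ultimately show ?case
    using IH insert.hyps assms(3) independent_insertI[of "e j" "B \<union> e ` J"] by simp
qed

lemma (in vector_space) dim_quotient_ge:
  assumes "finite S" "V \<subseteq> span S" "subspace W" "W \<subseteq> V" "subspace V"
    and "finite J" "\<And>j. j \<in> J \<Longrightarrow> e j \<in> V"
    and indep: "\<And>c. (\<Sum>j\<in>J. scale (c j) (e j)) \<in> W \<Longrightarrow> \<forall>j\<in>J. c j = 0"
  shows "dim W + card J \<le> dim V"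
proof -
  obtain B where B: "B \<subseteq> W" "independent B" "W \<subseteq> span B" "card B = dim W"
    using basis_exists by blast
  have W: "span B = W"
    using B assms(3) span_minimal by blast
  have "finite B"
    using independent_span_bound[OF assms(1) B(2)] B(1) assms(2,4) by blast
  hence *: "independent (B \<union> e ` J) \<and> card (B \<union> e ` J) = card B + card J"
    using assms(6) B(2) indep W by (intro independent_extend) auto
  obtain C where C: "C \<subseteq> V" "independent C" "V \<subseteq> span C" "card C = dim V"
    using basis_exists by blast
  have "finite C"
    using independent_span_bound[OF assms(1) C(2)] C(1) assms(2) by blast
  have "B \<union> e ` J \<subseteq> span C"
    using B(1) assms(4,7) C(3) by blast
  hence "card (B \<union> e ` J) \<le> card C"
    using independent_span_bound[OF \<open>finite C\<close>] * by blast
  thus ?thesis using * B(4) C(4) by simp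
qed

lemma (in vector_space) dim_quotient_le:
  assumes "finite S" "W \<subseteq> span S" "finite J"
    and spanning: "\<And>x. x \<in> V \<Longrightarrow> \<exists>c. x - (\<Sum>j\<in>J. scale (c j) (e j)) \<in> W"
  shows "dim V \<le> dim W + card J"
proof -
  obtain B where B: "B \<subseteq> W" "independent B" "W \<subseteq> span B" "card B = dim W"
    using basis_exists by blast
  have "finite B"
    using independent_span_bound[OF assms(1) B(2)] B(1) assms(2) by blast
  have "V \<subseteq> span (B \<union> e ` J)"
  proof
    fix x assume "x \<in> V"
    then obtain c where "x - (\<Sum>j\<in>J. scale (c j) (e j)) \<in> W"
      using spanning by blast
    hence "x - (\<Sum>j\<in>J. scale (c j) (e j)) \<in> span (B \<union> e ` J)"
      using B(3) span_mono[of B "B \<union> e ` J"] by blast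
    moreover have "(\<Sum>j\<in>J. scale (c j) (e j)) \<in> span (B \<union> e ` J)"
      by (intro span_sum span_scale span_base) auto
    ultimately have "(x - (\<Sum>j\<in>J. scale (c j) (e j))) + (\<Sum>j\<in>J. scale (c j) (e j)) \<in> span (B \<union> e ` J)"
      by (rule span_add)
    thus "x \<in> span (B \<union> e ` J)" by simp
  qed
  hence "dim V \<le> card (B \<union> e ` J)"
    using \<open>finite B\<close> assms(3) by (intro dim_le_card) auto
  also have "\<dots> \<le> card B + card J"
    using card_Un_le[of B "e ` J"] card_image_le[OF assms(3), of e] by linarith
  finally show ?thesis using B(4) by simp
qed

lemma finite_monoms_bounded: "finite {m :: 'v::finite monom. mdeg m \<le> d}"
proof -
  have "Poly_Mapping.lookup m v \<le> mdeg m" for m :: "'v monom" and v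
    unfolding mdeg_def by (intro member_le_sum) auto
  hence "Poly_Mapping.lookup ` {m :: 'v monom. mdeg m \<le> d} \<subseteq> PiE UNIV (\<lambda>_. {..d})"
    by (auto intro: order_trans)
  hence "finite (Poly_Mapping.lookup ` {m :: 'v monom. mdeg m \<le> d})"
    by (rule finite_subset) (intro finite_PiE, auto)
  thus ?thesis
    by (rule finite_imageD) (auto intro!: inj_onI poly_mapping_eqI)
qed

definition monomials_upto :: "nat \<Rightarrow> 'v::finite mpoly set" where
  "monomials_upto d = (\<lambda>m. Poly_Mapping.single m 1) ` {m. mdeg m \<le> d}"

lemma finite_monomials_upto: "finite (monomials_upto d)"
  by (simp add: monomials_upto_def finite_monoms_bounded)

lemma smul_single: "smul c (Poly_Mapping.single m b) = Poly_Mapping.single m (c * b)"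
  by (simp add: smul_def mult_single)

lemma in_span_monomials_upto:
  assumes "\<And>m. m \<in> Poly_Mapping.keys p \<Longrightarrow> mdeg m \<le> d"
  shows "p \<in> mpoly.span (monomials_upto d)"
proof -
  have "(\<Sum>m\<in>Poly_Mapping.keys p. smul (Poly_Mapping.lookup p m) (Poly_Mapping.single m 1))
      \<in> mpoly.span (monomials_upto d)"
    by (intro mpoly.span_sum mpoly.span_scale mpoly.span_base) (auto simp: monomials_upto_def assms)
  thus ?thesis
    by (subst mpoly_eq_sum_single) (simp add: smul_single)
qed

lemma forms_subset_span: "{p. is_form d p} \<subseteq> mpoly.span (monomials_upto d)"
  by (auto simp: is_form_def intro: in_span_monomials_upto)

text \<open>
  Together with its companion below, this reduces every statement about Hilbert functions to exhibiting
  families of forms that are independent, or spanning, modulo the ideal. Independence says at once that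
  the listed forms are distinct, hence the bound by the number of indices.
\<close>

lemma hilbert_function_ge:
  fixes I :: "'v::finite mpoly set"
  assumes "is_ideal I" "finite J" "\<And>j. j \<in> J \<Longrightarrow> is_form d (e j)"
    and "\<And>c. (\<Sum>j\<in>J. smul (c j) (e j)) \<in> I \<Longrightarrow> \<forall>j\<in>J. c j = 0"
  shows "card J \<le> hilbert_function I d"
proof -
  have "{p \<in> I. is_form d p} = I \<inter> {p. is_form d p}" by auto
  hence "mpoly.subspace {p \<in> I. is_form d p}"
    using mpoly.subspace_inter[OF subspace_ideal[OF assms(1)] subspace_forms] by simp
  hence "mpoly.dim {p \<in> I. is_form d p} + card J \<le> mpoly.dim {p :: 'v mpoly. is_form d p}"
    using assms by (intro mpoly.dim_quotient_ge[OF finite_monomials_upto forms_subset_span _ _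
      subspace_forms, where e = e]) auto
  thus ?thesis unfolding hilbert_function_def by linarith
qed

lemma hilbert_function_le:
  fixes I :: "'v::finite mpoly set"
  assumes "finite J"
    and "\<And>p. is_form d p \<Longrightarrow>
       \<exists>c. p - (\<Sum>j\<in>J. smul (c j) (e j)) \<in> I \<and> is_form d (p - (\<Sum>j\<in>J. smul (c j) (e j)))"
  shows "hilbert_function I d \<le> card J"
proof -
  have "mpoly.dim {p :: 'v mpoly. is_form d p} \<le> mpoly.dim {p \<in> I. is_form d p} + card J"
    using assms forms_subset_span
    by (intro mpoly.dim_quotient_le[where e = e, OF finite_monomials_upto[of d]]) blast+
  thus ?thesis unfolding hilbert_function_def by linarith
qed

lemma hilbert_function_basis:
  fixes I :: "'v::finite mpoly set"
  assumes "is_ideal I"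
  obtains E where "finite E" "card E = hilbert_function I d" "\<And>p. p \<in> E \<Longrightarrow> is_form d p"
    "\<And>c. (\<Sum>p\<in>E. smul (c p) p) \<in> I \<Longrightarrow> \<forall>p\<in>E. c p = 0"
proof -
  let ?W = "{p \<in> I. is_form d p}" and ?V = "{p :: 'v mpoly. is_form d p}"
  obtain B where B: "B \<subseteq> ?W" "mpoly.independent B" "?W \<subseteq> mpoly.span B" "card B = mpoly.dim ?W"
    using mpoly.basis_exists by blast
  obtain C where C: "B \<subseteq> C" "C \<subseteq> ?V" "mpoly.independent C" "?V \<subseteq> mpoly.span C"
    using mpoly.maximal_independent_subset_extend[of B ?V] B by blast
  have fC: "finite C"
    using mpoly.independent_span_bound[OF finite_monomials_upto C(3)] C(2) forms_subset_span by blast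
  have cardC: "card C = mpoly.dim ?V"
    using C mpoly.basis_card_eq_dim by blast
  have "\<forall>p\<in>C - B. c p = 0" if "(\<Sum>p\<in>C - B. smul (c p) p) \<in> I" for c
  proof
    fix p assume p: "p \<in> C - B"
    let ?x = "\<Sum>p\<in>C - B. smul (c p) p"
    have "?x \<in> ?V"
      using C(2) by (auto intro!: is_form_sum is_form_smul)
    hence "?x \<in> mpoly.span B"
      using that B(3) by blast
    then obtain b where b: "?x = (\<Sum>p\<in>B. smul (b p) p)"
      using mpoly.span_finite[of B] fC C(1) finite_subset by blast
    define a where "a p = (if p \<in> B then - b p else c p)" for p
    have "(\<Sum>p\<in>C. smul (a p) p) = (\<Sum>p\<in>B. smul (a p) p) + (\<Sum>p\<in>C - B. smul (a p) p)"
      using fC C(1) by (metis (no_types, lifting) add.commute sum.subset_diff)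
    also have "(\<Sum>p\<in>B. smul (a p) p) = - ?x"
      unfolding b sum_negf[symmetric] by (intro sum.cong) (auto simp: a_def)
    also have "(\<Sum>p\<in>C - B. smul (a p) p) = ?x"
      by (intro sum.cong) (auto simp: a_def)
    finally have "(\<Sum>p\<in>C. smul (a p) p) = 0" by simp
    hence "a p = 0"
      using mpoly.independentD[OF C(3) fC order_refl] p by blast
    thus "c p = 0" using p by (simp add: a_def)
  qed
  moreover have "card (C - B) = hilbert_function I d"
    using B C fC cardC unfolding hilbert_function_def by (simp add: card_Diff_subset finite_subset)
  ultimately show ?thesis
    using C(2) fC by (intro that[of "C - B"]) auto
qed

text \<open>
  Multiplication by a nonzerodivisor preserves independence modulo the ideal.
\<close>

lemma hilbert_function_mono_mult:
  fixes I :: "'v::finite mpoly set"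
  assumes "is_ideal I" "is_form e l" "\<And>p. l * p \<in> I \<Longrightarrow> p \<in> I"
  shows "hilbert_function I d \<le> hilbert_function I (e + d)"
proof -
  obtain E where E: "finite E" "card E = hilbert_function I d" "\<And>p. p \<in> E \<Longrightarrow> is_form d p"
    "\<And>c. (\<Sum>p\<in>E. smul (c p) p) \<in> I \<Longrightarrow> \<forall>p\<in>E. c p = 0"
    by (rule hilbert_function_basis[OF assms(1), of d]) blast
  have "card E \<le> hilbert_function I (e + d)"
  proof (rule hilbert_function_ge[OF assms(1) E(1), where e = "\<lambda>p. l * p"])
    fix c assume "(\<Sum>p\<in>E. smul (c p) (l * p)) \<in> I"
    hence "l * (\<Sum>p\<in>E. smul (c p) p) \<in> I"
      by (simp add: sum_distrib_left smul_mult)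
    thus "\<forall>p\<in>E. c p = 0" using E(4) assms(3) by blast
  qed (auto intro: is_form_mult assms(2) E(3))
  thus ?thesis using E(2) by simp
qed

section \<open>Nonzerodivisors modulo a saturated ideal\<close>

definition ideal_radical :: "'a::comm_ring_1 set \<Rightarrow> 'a set" where
  "ideal_radical J = {x. \<exists>k. x ^ k \<in> J}"

lemma is_ideal_ideal_radical:
  assumes J: "is_ideal J"
  shows "is_ideal (ideal_radical J)"
  unfolding is_ideal_def
proof (intro conjI ballI allI)
  show "0 \<in> ideal_radical J"
    using J unfolding ideal_radical_def is_ideal_def by (auto intro!: exI[of _ 1])
next
  fix a b assume "a \<in> ideal_radical J" "b \<in> ideal_radical J"
  then obtain k l where k: "a ^ k \<in> J" and l: "b ^ l \<in> J"
    by (auto simp: ideal_radical_def)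
  \<comment> \<open>Each term of the binomial expansion contains \<open>a ^ k\<close> or \<open>b ^ l\<close>.\<close>
  have "of_nat ((k + l) choose i) * a ^ i * b ^ (k + l - i) \<in> J" if "i \<le> k + l" for i
  proof (cases "k \<le> i")
    case True
    have "a ^ i = a ^ (i - k) * a ^ k"
      using True by (simp flip: power_add)
    hence "of_nat ((k + l) choose i) * a ^ i * b ^ (k + l - i) =
        (of_nat ((k + l) choose i) * a ^ (i - k) * b ^ (k + l - i)) * a ^ k"
      by (simp only: mult_ac)
    thus ?thesis using is_ideal_mult[OF J k] by simp
  next
    case False
    have "b ^ (k + l - i) = b ^ (k - i) * b ^ l"
      using False by (simp flip: power_add)
    hence "of_nat ((k + l) choose i) * a ^ i * b ^ (k + l - i) =
        (of_nat ((k + l) choose i) * a ^ i * b ^ (k - i)) * b ^ l"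
      by (simp only: mult.assoc)
    thus ?thesis using is_ideal_mult[OF J l] by simp
  qed
  hence "(a + b) ^ (k + l) \<in> J"
    unfolding binomial_ring by (intro is_ideal_sum[OF J]) auto
  thus "a + b \<in> ideal_radical J" by (auto simp: ideal_radical_def)
next
  fix a c assume "a \<in> ideal_radical J"
  then obtain k where "a ^ k \<in> J" by (auto simp: ideal_radical_def)
  hence "(c * a) ^ k \<in> J"
    unfolding power_mult_distrib by (rule is_ideal_mult[OF J])
  thus "c * a \<in> ideal_radical J" by (auto simp: ideal_radical_def)
qed

lemma radical_power: "x ^ k \<in> ideal_radical J \<Longrightarrow> x \<in> ideal_radical J"
  by (auto simp: ideal_radical_def simp flip: power_mult)

definition colon :: "'a::comm_ring_1 set \<Rightarrow> 'a \<Rightarrow> 'a set" where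
  "colon I p = {c. c * p \<in> I}"

lemma is_ideal_colon: "is_ideal I \<Longrightarrow> is_ideal (colon I p)"
  by (auto simp: is_ideal_def colon_def ring_distribs mult.assoc)

text \<open>
  The elements that some power of \<open>g\<close> multiplies into \<open>I\<close>. The definition through the radical of the
  colon ideal lets the ideal structure in the variable \<open>g\<close> be used: for a fixed \<open>p\<close>, the \<open>g\<close> with
  \<open>p \<in> power_torsion I g\<close> form a radical ideal.
\<close>

definition power_torsion :: "'a::comm_ring_1 set \<Rightarrow> 'a \<Rightarrow> 'a set" where
  "power_torsion I g = {p. g \<in> ideal_radical (colon I p)}"

lemma power_torsion_iff: "p \<in> power_torsion I g \<longleftrightarrow> (\<exists>k. g ^ k * p \<in> I)"
  by (simp add: power_torsion_def ideal_radical_def colon_def)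

lemma is_ideal_power_torsion:
  assumes I: "is_ideal I"
  shows "is_ideal (power_torsion I g)"
  unfolding is_ideal_def
proof (intro conjI ballI allI)
  show "0 \<in> power_torsion I g"
    using I by (auto simp: power_torsion_iff is_ideal_def)
next
  fix a b assume "a \<in> power_torsion I g" "b \<in> power_torsion I g"
  then obtain k l where k: "g ^ k * a \<in> I" and l: "g ^ l * b \<in> I"
    by (auto simp: power_torsion_iff)
  have "g ^ l * (g ^ k * a) + g ^ k * (g ^ l * b) \<in> I"
    using I is_ideal_mult[OF I k] is_ideal_mult[OF I l] unfolding is_ideal_def by blast
  hence "g ^ (k + l) * (a + b) \<in> I"
    by (simp add: power_add algebra_simps)
  thus "a + b \<in> power_torsion I g" by (auto simp: power_torsion_iff)
next
  fix a c assume "a \<in> power_torsion I g"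
  then obtain k where "g ^ k * a \<in> I" by (auto simp: power_torsion_iff)
  hence "g ^ k * (c * a) \<in> I"
    using is_ideal_mult[OF I, of _ c] by (metis mult.left_commute)
  thus "c * a \<in> power_torsion I g" by (auto simp: power_torsion_iff)
qed

text \<open>
  Two distinct members of the pencil spanned by \<open>g\<close> and \<open>w\<close> generate both \<open>g\<close> and \<open>w\<close>. If a prime ideal
  contains one member and a product of others, it contains a second one and therefore \<open>g\<close> and \<open>w\<close>.
  The proof below is this argument without primes. It trades the factors of the product for powers of
  \<open>w\<close> one by one, since \<open>g + t w\<close> and \<open>(t - s) w\<close> agree modulo \<open>g + s w\<close>.
\<close>

lemma radical_pencil:
  fixes g w :: "'v mpoly"
  assumes R: "is_ideal R" "\<And>x k. x ^ k \<in> R \<Longrightarrow> x \<in> R"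
    and "finite T" "s \<notin> T" "g + smul s w \<in> R" "(\<Prod>t\<in>T. g + smul t w) \<in> R"
  shows "g \<in> R \<and> w \<in> R"
proof -
  have "w \<in> R"
  proof -
    have "w ^ k * z \<in> R \<Longrightarrow> w \<in> R" if "z = (\<Prod>t\<in>T. g + smul t w)" for k z
      using assms(3,4) that
    \<comment> \<open>The exponent \<open>k\<close> counts the factors of the product already traded for \<open>w\<close>.\<close>
    proof (induction T arbitrary: k z rule: finite_induct)
      case empty
      thus ?case using R(2) by simp
    next
      case (insert t T)
      define z' where "z' = (\<Prod>t\<in>T. g + smul t w)"
      have "z = (g + smul t w) * z'"
        using insert by (simp add: z'_def)
      hence a: "w ^ k * z' * (g + smul t w) \<in> R"
        using insert.prems by (simp add: mult_ac)
      have b: "w ^ k * z' * (g + smul s w) \<in> R"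
        using assms(5) R(1) is_ideal_mult by blast
      have "w ^ k * z' * (g + smul t w) + - (w ^ k * z' * (g + smul s w)) \<in> R"
        using a is_ideal_uminus[OF R(1) b] R(1) unfolding is_ideal_def by blast
      also have "w ^ k * z' * (g + smul t w) + - (w ^ k * z' * (g + smul s w)) =
          smul (t - s) (w ^ Suc k * z')"
        by (simp add: smul_def single_diff algebra_simps)
      finally have "smul (1 / (t - s)) (smul (t - s) (w ^ Suc k * z')) \<in> R"
        by (rule is_ideal_smul[OF R(1)])
      moreover have "t - s \<noteq> 0" using insert.prems by auto
      ultimately have "w ^ Suc k * z' \<in> R" by simp
      thus ?case
        using insert.IH[of "Suc k" z'] insert.prems by (simp add: z'_def)
    qed
    from this[OF refl, of 0] assms(6) show ?thesis by simp
  qed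
  moreover have "(g + smul s w) + - (smul s w) \<in> R"
    using is_ideal_uminus[OF R(1) is_ideal_smul[OF R(1) \<open>w \<in> R\<close>]] assms(5) R(1)
    unfolding is_ideal_def by blast
  ultimately show ?thesis by simp
qed

text \<open>
  The product of the \<open>x t\<close> serves as a common torsion multiplier for elements with different multipliers.
\<close>

lemma sum_torsion:
  fixes x :: "'i \<Rightarrow> 'a::comm_ring_1"
  assumes I: "is_ideal I" and "finite T" "\<And>t. t \<in> T \<Longrightarrow> a t \<in> power_torsion I (x t)"
  shows "(\<Sum>t\<in>T. c t * a t) \<in> power_torsion I (\<Prod>t\<in>T. x t)"
proof (intro is_ideal_sum is_ideal_power_torsion[OF I])
  fix t assume t: "t \<in> T"
  then obtain k where k: "x t ^ k * a t \<in> I"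
    using assms(3) by (auto simp: power_torsion_iff)
  have "(\<Prod>t\<in>T. x t) ^ k * (c t * a t) = ((\<Prod>t\<in>T-{t}. x t) ^ k * c t) * (x t ^ k * a t)"
    using t assms(2) by (subst prod.remove[of _ t]) (auto simp: power_mult_distrib mult_ac)
  also have "\<dots> \<in> I"
    by (rule is_ideal_mult[OF I k])
  finally show "c t * a t \<in> power_torsion I (\<Prod>t\<in>T. x t)"
    by (auto simp: power_torsion_iff)
qed

text \<open>
  Geometrically: a general member of the pencil vanishes at an associated point of \<open>I\<close> only if the whole
  pencil does. Suppose that every member \<open>g + t w\<close> has a torsion element \<open>a t\<close> that is not
  torsion for both \<open>g\<close> and \<open>w\<close>. If \<open>a s\<close> were a combination of other \<open>a t\<close>, it would be torsion for \<open>g + s w\<close>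
  and for a product of other members of the pencil, hence by \<open>radical_pencil\<close> for \<open>g\<close> and \<open>w\<close>. So the \<open>a t\<close>
  are linearly independent. There are uncountably many, so infinitely many of them lie in the polynomials
  of some bounded degree, a space of finite dimension.
\<close>

lemma exists_torsion_pencil:
  fixes I :: "'v::finite mpoly set"
  assumes I: "is_ideal I"
  shows "\<exists>t. power_torsion I (g + smul t w) \<subseteq> power_torsion I g \<inter> power_torsion I w"
proof (rule ccontr)
  assume "\<not> ?thesis"
  hence "\<forall>t. \<exists>a. a \<in> power_torsion I (g + smul t w) \<and> a \<notin> power_torsion I g \<inter> power_torsion I w"
    by blast
  then obtain a where a: "\<And>t. a t \<in> power_torsion I (g + smul t w)"
    "\<And>t. a t \<notin> power_torsion I g \<inter> power_torsion I w"
    by metis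
  \<comment> \<open>Real parameters already are uncountably many. \<open>D t\<close> bounds the degree of \<open>a t\<close>.\<close>
  define D where "D t = Max (insert 0 (mdeg ` Poly_Mapping.keys (a (of_real t))))" for t :: real
  have D: "a (of_real t) \<in> mpoly.span (monomials_upto (D t))" for t
    unfolding D_def by (intro in_span_monomials_upto Max_ge) auto
  have "\<exists>d. infinite (D -` {d})"
  proof (rule ccontr)
    assume "\<not> ?thesis"
    hence "countable (\<Union>d. D -` {d})"
      by (intro countable_UN) (auto intro: countable_finite)
    moreover have "(\<Union>d. D -` {d}) = UNIV" by auto
    ultimately show False using uncountable_UNIV_real by simp
  qed
  then obtain d where d: "infinite (D -` {d})" by blast
  let ?V = "mpoly.span (monomials_upto d) :: 'v mpoly set"
  obtain T where T: "finite T" "card T = Suc (mpoly.dim ?V)" "T \<subseteq> D -` {d}"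
    using infinite_arbitrarily_large[OF d] by blast
  have "mpoly.dim {0 :: 'v mpoly} + card T \<le> mpoly.dim ?V"
  proof (rule mpoly.dim_quotient_ge[OF finite_monomials_upto[of d], where e = "\<lambda>t. a (of_real t)"])
    fix c :: "real \<Rightarrow> complex"
    assume *: "(\<Sum>t\<in>T. smul (c t) (a (of_real t))) \<in> {0}"
    show "\<forall>t\<in>T. c t = 0"
    proof (rule ccontr)
      assume "\<not> ?thesis"
      then obtain s where s: "s \<in> T" "c s \<noteq> 0" by blast
      \<comment> \<open>Solving the relation for \<open>a s\<close> presents it as a combination of the other elements.\<close>
      let ?S' = "\<Sum>t\<in>T-{s}. Poly_Mapping.single 0 (- c t / c s) * a (of_real t)"
      have "smul (c s) (a (of_real s)) + (\<Sum>t\<in>T-{s}. smul (c t) (a (of_real t))) = 0"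
        using * sum.remove[OF T(1) s(1), of "\<lambda>t. smul (c t) (a (of_real t))"] by simp
      hence "smul (c s) (a (of_real s)) = - (\<Sum>t\<in>T-{s}. smul (c t) (a (of_real t)))"
        by (simp only: eq_neg_iff_add_eq_0)
      hence "smul (1 / c s) (smul (c s) (a (of_real s))) =
          smul (1 / c s) (- (\<Sum>t\<in>T-{s}. smul (c t) (a (of_real t))))"
        by (simp only:)
      hence "a (of_real s) = (\<Sum>t\<in>T-{s}. smul (- c t / c s) (a (of_real t)))"
        using s(2) by (simp add: mpoly.scale_sum_right mpoly.scale_minus_left sum_negf)
      also have "\<dots> = ?S'"
        by (simp add: smul_def)
      finally have S': "a (of_real s) = ?S'" .
      have "?S' \<in> power_torsion I (\<Prod>t\<in>T-{s}. g + smul (of_real t) w)"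
        using T(1) a(1) by (intro sum_torsion[OF I]) auto
      hence 1: "(\<Prod>t\<in>T-{s}. g + smul (of_real t) w) \<in> ideal_radical (colon I (a (of_real s)))"
        using S' by (simp add: power_torsion_def)
      have 2: "g + smul (of_real s) w \<in> ideal_radical (colon I (a (of_real s)))"
        using a(1) by (simp add: power_torsion_def)
      have "g \<in> ideal_radical (colon I (a (of_real s))) \<and> w \<in> ideal_radical (colon I (a (of_real s)))"
      proof (rule radical_pencil[OF is_ideal_ideal_radical[OF is_ideal_colon[OF I]] radical_power _ _ 2])
        show "(\<Prod>t\<in>complex_of_real ` (T - {s}). g + smul t w) \<in> ideal_radical (colon I (a (of_real s)))"
          using 1 by (subst prod.reindex) (auto simp: inj_on_def o_def)
      qed (use T in auto)
      with a(2)[of "of_real s"] show False by (simp add: power_torsion_def)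
    qed
  qed (use T D in \<open>auto simp: mpoly.subspace_0 mpoly.span_zero\<close>)
  thus False using T(2) by simp
qed

text \<open>
  Adding the generators to the linear system one at a time, each time choosing a good member of the
  pencil spanned by the previous choice and the new generator.
\<close>

lemma exists_torsion_free_combination:
  fixes I :: "'v::finite mpoly set"
  assumes I: "is_ideal I" and "finite W"
  shows "\<exists>g\<in>mpoly.span W. power_torsion I g \<subseteq> {p. \<forall>w\<in>W. p \<in> power_torsion I w}"
  using assms(2)
proof (induction W rule: finite_induct)
  case empty
  show ?case by (auto intro: mpoly.span_zero)
next
  case (insert w W)
  then obtain g where g: "g \<in> mpoly.span W"
    "power_torsion I g \<subseteq> {p. \<forall>w\<in>W. p \<in> power_torsion I w}"
    by blast
  obtain t where t: "power_torsion I (g + smul t w) \<subseteq> power_torsion I g \<inter> power_torsion I w"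
    using exists_torsion_pencil[OF I] by blast
  have "g + smul t w \<in> mpoly.span (insert w W)"
    using mpoly.span_mono[of W "insert w W"] g(1)
    by (intro mpoly.span_add mpoly.span_scale mpoly.span_base[of w]) auto
  moreover have "power_torsion I (g + smul t w) \<subseteq> {p. \<forall>w\<in>insert w W. p \<in> power_torsion I w}"
    using t g(2) by blast
  ultimately show ?case by blast
qed

lemma Var_power: "Var v ^ k = Poly_Mapping.single (Poly_Mapping.single v k) 1"
proof (induction k)
  case (Suc k)
  show ?case
    by (simp only: power_Suc Suc.IH) (simp add: Var_def mult_single flip: single_add)
qed simp

text \<open>
  If \<open>J\<close> contains the power \<open>k v\<close> of each variable \<open>v\<close>, then every monomial of degree larger than the sum of
  the \<open>k v\<close> is a multiple of one of these powers.
\<close>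

lemma large_forms_in_ideal:
  fixes J :: "'v::finite mpoly set"
  assumes J: "is_ideal J" and vars: "\<And>v. Var v \<in> ideal_radical J"
  shows "\<exists>k. \<forall>g. is_form k g \<longrightarrow> g \<in> J"
proof -
  have "\<forall>v. \<exists>k. Var v ^ k \<in> J"
    using vars by (simp add: ideal_radical_def)
  from choice[OF this] obtain k where k: "\<And>v. Var v ^ k v \<in> J"
    by blast
  define N where "N = (\<Sum>v\<in>UNIV. k v)"
  have single: "Poly_Mapping.single m c \<in> J" if m: "mdeg m = Suc N" for m c
  proof -
    have "\<exists>v. k v \<le> Poly_Mapping.lookup m v"
    proof (rule ccontr)
      assume "\<not> ?thesis"
      hence "mdeg m \<le> N"
        unfolding mdeg_def N_def by (intro sum_mono) (auto simp: not_le less_imp_le)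
      thus False using m by simp
    qed
    then obtain v where v: "k v \<le> Poly_Mapping.lookup m v" by blast
    note monom_diff_add_single[OF v]
    hence "Poly_Mapping.single m c =
        Poly_Mapping.single (m - Poly_Mapping.single v (k v)) c * Var v ^ k v"
      by (simp add: Var_power mult_single)
    thus ?thesis using is_ideal_mult[OF J k] by metis
  qed
  have "g \<in> J" if "is_form (Suc N) g" for g
    by (subst mpoly_eq_sum_single) (use that in \<open>auto intro!: is_ideal_sum[OF J] single simp: is_form_def\<close>)
  thus ?thesis by blast
qed

text \<open>
  The hypothesis on \<open>W\<close> says that its elements have no common zero in projective space: every radical
  ideal containing them contains the irrelevant ideal. An element annihilated by powers of all of
  \<open>W\<close> modulo \<open>I\<close> is then annihilated by all forms of some large degree, so it lies in \<open>I\<close> by saturation. Hence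
  the combination with the smallest torsion has none.
\<close>

lemma exists_nonzerodivisor:
  fixes I :: "'v::finite mpoly set"
  assumes I: "is_ideal I" "saturated I" and W: "finite W"
    and base_point_free: "\<And>R v. is_ideal R \<Longrightarrow> (\<And>x k. x ^ k \<in> R \<Longrightarrow> x \<in> R) \<Longrightarrow> W \<subseteq> R \<Longrightarrow> Var v \<in> R"
  obtains g where "g \<in> mpoly.span W" "\<And>p. g * p \<in> I \<Longrightarrow> p \<in> I"
proof -
  obtain g where g: "g \<in> mpoly.span W"
    "power_torsion I g \<subseteq> {p. \<forall>w\<in>W. p \<in> power_torsion I w}"
    using exists_torsion_free_combination[OF I(1) W] by blast
  have "p \<in> I" if "g * p \<in> I" for p
  proof -
    have "p \<in> power_torsion I g"
      unfolding power_torsion_iff using that by (intro exI[of _ 1]) simp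
    hence "W \<subseteq> ideal_radical (colon I p)"
      using g(2) by (auto simp: power_torsion_def)
    hence "Var v \<in> ideal_radical (colon I p)" for v
      using I(1) by (intro base_point_free is_ideal_ideal_radical is_ideal_colon) (auto intro: radical_power)
    hence "\<exists>k. \<forall>g. is_form k g \<longrightarrow> g \<in> colon I p"
      using I(1) by (intro large_forms_in_ideal is_ideal_colon) auto
    thus "p \<in> I"
      using I(2) by (auto simp: saturated_def colon_def)
  qed
  with g(1) that show ?thesis by blast
qed

section \<open>The product of the quadrics and its apolar quadrics\<close>

lemma UNIV_xy_var: "(UNIV :: 'n xy_var set) = insert X1 (insert X2 (range Y))"
  by (auto intro: xy_var.exhaust)

lemma card_xy_var: "CARD('n::finite xy_var) = CARD('n) + 2"
  unfolding UNIV_xy_var by (simp add: card_insert_if image_iff card_image inj_on_def)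

lemma sum_xy_var: "(\<Sum>v\<in>(UNIV :: 'n::finite xy_var set). f v) = f X1 + f X2 + (\<Sum>j\<in>UNIV. f (Y j))"
  unfolding UNIV_xy_var by (simp add: sum.reindex inj_on_def image_iff add.assoc)

lemma prod_xy_var: "(\<Prod>v\<in>(UNIV :: 'n::finite xy_var set). f v) = f X1 * f X2 * (\<Prod>j\<in>UNIV. f (Y j))"
  unfolding UNIV_xy_var by (simp add: prod.reindex inj_on_def image_iff mult.assoc)

text \<open>
  The part of the monomial in the variables \<open>y_j\<close> is the square of one of them.
\<close>

definition y_square :: "'n xy_var monom \<Rightarrow> bool" where
  "y_square m \<longleftrightarrow> (\<exists>j. \<forall>i. Poly_Mapping.lookup m (Y i) = (if i = j then 2 else 0))"

definition quadric_product :: "'n::finite xy_var mpoly" where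
  "quadric_product = (Var X1 ^ 2 + Var X2 ^ 2) * (\<Sum>j\<in>UNIV. Var (Y j) ^ 2)"

lemma monom_xy_eq_iff:
  "m = Poly_Mapping.single X1 a + Poly_Mapping.single X2 b + Poly_Mapping.single (Y j) c \<longleftrightarrow>
   Poly_Mapping.lookup m X1 = a \<and> Poly_Mapping.lookup m X2 = b \<and>
   (\<forall>i. Poly_Mapping.lookup m (Y i) = (if i = j then c else 0))"
proof
  assume *: "Poly_Mapping.lookup m X1 = a \<and> Poly_Mapping.lookup m X2 = b \<and>
   (\<forall>i. Poly_Mapping.lookup m (Y i) = (if i = j then c else 0))"
  show "m = Poly_Mapping.single X1 a + Poly_Mapping.single X2 b + Poly_Mapping.single (Y j) c"
  proof (rule poly_mapping_eqI)
    fix v show "Poly_Mapping.lookup m v = Poly_Mapping.lookup (Poly_Mapping.single X1 a +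
        Poly_Mapping.single X2 b + Poly_Mapping.single (Y j) c) v"
      using * by (cases v) (auto simp: lookup_add lookup_single when_def)
  qed
qed (auto simp: lookup_add lookup_single when_def)

lemma mfact_xy:
  "mfact m = fact (Poly_Mapping.lookup m X1) * fact (Poly_Mapping.lookup m X2) *
     (\<Prod>j\<in>UNIV. fact (Poly_Mapping.lookup m (Y j)))"
  by (simp add: mfact_def prod_xy_var)

text \<open>
  The form is the sum of the monomials \<open>x1^2 y_j^2\<close> and \<open>x2^2 y_j^2\<close>, whose divided power factor is
  \<open>2! 2! = 4\<close>.
\<close>

lemma dp_coeff_quadric_product:
  fixes m :: "'n::finite xy_var monom"
  shows "dp_coeff quadric_product m =
     (if y_square m \<and> (Poly_Mapping.lookup m X1, Poly_Mapping.lookup m X2) \<in> {(2, 0), (0, 2)} then 4 else 0)"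
proof -
  let ?a = "Poly_Mapping.lookup m X1" and ?b = "Poly_Mapping.lookup m X2"
  let ?P = "\<lambda>j. \<forall>i. Poly_Mapping.lookup m (Y i) = (if i = j then 2 else 0)"
  have single: "Poly_Mapping.lookup (Poly_Mapping.single m' (1::complex)) m = (if m = m' then 1 else 0)" for m'
    by (auto simp: lookup_single when_def)
  have Q: "(quadric_product :: 'n xy_var mpoly) = (\<Sum>j\<in>UNIV.
      Poly_Mapping.single (Poly_Mapping.single X1 2 + Poly_Mapping.single X2 0 + Poly_Mapping.single (Y j) 2) 1 +
      Poly_Mapping.single (Poly_Mapping.single X1 0 + Poly_Mapping.single X2 2 + Poly_Mapping.single (Y j) 2) 1)"
    by (simp add: quadric_product_def sum_distrib_left Var_power distrib_right mult_single)
  have "Poly_Mapping.lookup quadric_product m = (\<Sum>j\<in>UNIV. (if ?a = 2 \<and> ?b = 0 \<and> ?P j then 1 else 0) +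
      (if ?a = 0 \<and> ?b = 2 \<and> ?P j then 1 else 0))"
    unfolding Q lookup_sum lookup_add[of _ _ m] single monom_xy_eq_iff by (rule refl)
  also have "\<dots> = (if (?a, ?b) \<in> {(2, 0), (0, 2)} then (\<Sum>j\<in>UNIV. if ?P j then 1 else 0) else 0)"
    by auto
  also have "\<dots> = (if y_square m \<and> (?a, ?b) \<in> {(2, 0), (0, 2)} then 1 else 0)"
  proof (cases "y_square m")
    case True
    then obtain k where k: "?P k" by (auto simp: y_square_def)
    have "?P j \<longleftrightarrow> j = k" for j
      using k by (metis zero_neq_numeral)
    thus ?thesis using True by simp
  next
    case False
    hence "?P j \<longleftrightarrow> False" for j
      unfolding y_square_def by blast
    hence "(\<Sum>j\<in>UNIV. if ?P j then 1 else 0) = (0 :: complex)"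
      by (intro sum.neutral ballI) (simp only: if_False)
    thus ?thesis using False by simp
  qed
  finally have L: "Poly_Mapping.lookup quadric_product m =
      (if y_square m \<and> (?a, ?b) \<in> {(2, 0), (0, 2)} then 1 else 0)" .
  have "mfact m = 4" if "y_square m" "(?a, ?b) \<in> {(2, 0), (0, 2)}"
  proof -
    from that(1) obtain k where k: "?P k" by (auto simp: y_square_def)
    have "(\<Prod>j\<in>UNIV. fact (Poly_Mapping.lookup m (Y j))) = (\<Prod>j\<in>UNIV. if j = k then 2 else (1::complex))"
      using k by (intro prod.cong) (auto simp: fact_2)
    thus ?thesis using that(2) by (auto simp: mfact_xy fact_2)
  qed
  thus ?thesis by (simp add: dp_coeff_def L)
qed

lemma Var_mult: "Var v * Var w = Poly_Mapping.single (Poly_Mapping.single v 1 + Poly_Mapping.single w 1) 1"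
  by (simp add: Var_def mult_single)

lemma y_square_cong:
  assumes "\<And>i. Poly_Mapping.lookup m (Y i) = Poly_Mapping.lookup m' (Y i)"
  shows "y_square m \<longleftrightarrow> y_square m'"
  using assms by (simp add: y_square_def)

lemma weighted_sum_diff: "weighted_sum f (p - q) = weighted_sum f p - weighted_sum f q"
  using weighted_sum_add[of f "p - q" q] by simp

text \<open>
  The quadrics apolar to the two factors \<open>x1^2 + x2^2\<close> and \<open>y_1^2 + ... + y_n^2\<close>. They span the
  quadrics apolar to the product.
\<close>

definition perp_quadrics :: "'n::finite xy_var mpoly set" where
  "perp_quadrics = {Var X1 * Var X2, Var X1 ^ 2 - Var X2 ^ 2} \<union>
     {Var (Y i) * Var (Y j) | i j. i \<noteq> j} \<union> {Var (Y i) ^ 2 - Var (Y j) ^ 2 | i j. True}"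

lemma finite_perp_quadrics: "finite (perp_quadrics :: 'n::finite xy_var mpoly set)"
proof -
  have "{Var (Y i) * Var (Y j) | i j :: 'n. i \<noteq> j} \<subseteq> (\<lambda>(i, j). Var (Y i) * Var (Y j)) ` UNIV"
    "{Var (Y i) ^ 2 - Var (Y j) ^ 2 | i j :: 'n. True} \<subseteq> (\<lambda>(i, j). Var (Y i) ^ 2 - Var (Y j) ^ 2) ` UNIV"
    by auto
  from this[THEN finite_subset] show ?thesis unfolding perp_quadrics_def by simp
qed

lemma y_square_add_2:
  "y_square (m + Poly_Mapping.single (Y i) 2) \<longleftrightarrow> (\<forall>k. Poly_Mapping.lookup m (Y k) = 0)"
proof
  assume "y_square (m + Poly_Mapping.single (Y i) 2)"
  then obtain j where j: "\<And>k. Poly_Mapping.lookup m (Y k) + (if i = k then 2 else 0) = (if k = j then 2 else 0)"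
    by (auto simp: y_square_def lookup_add lookup_single when_def)
  have "i = j" using j[of i] by (auto split: if_splits)
  have "Poly_Mapping.lookup m (Y k) = 0" for k
    using j[of k] \<open>i = j\<close> by (auto split: if_splits)
  thus "\<forall>k. Poly_Mapping.lookup m (Y k) = 0" ..
qed (auto simp: y_square_def lookup_add lookup_single when_def intro!: exI[of _ i])

lemma not_y_square_add:
  assumes "i \<noteq> j"
  shows "\<not> y_square (m + (Poly_Mapping.single (Y i) 1 + Poly_Mapping.single (Y j) 1))"
proof
  assume "y_square (m + (Poly_Mapping.single (Y i) 1 + Poly_Mapping.single (Y j) 1))"
  then obtain k where k: "\<And>l. Poly_Mapping.lookup m (Y l) + ((if i = l then Suc 0 else 0) + (if j = l then Suc 0 else 0)) =
      (if l = k then 2 else 0)"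
    by (auto simp: y_square_def lookup_add lookup_single when_def)
  have "i = k" using k[of i] by (auto split: if_splits)
  moreover have "j = k" using k[of j] by (auto split: if_splits)
  ultimately show False using assms by simp
qed

lemma perp_quadrics_subset_perp:
  "perp_quadrics \<subseteq> perp (quadric_product :: 'n::finite xy_var mpoly)"
proof -
  have y: "y_square (m + Poly_Mapping.single v k) \<longleftrightarrow> y_square m" if "v = X1 \<or> v = X2"
    for m :: "'n xy_var monom" and v k
    using that by (intro y_square_cong) (auto simp: lookup_add lookup_single when_def)
  have "Var X1 * Var X2 \<in> perp (quadric_product :: 'n xy_var mpoly)"
    by (auto simp: perp_eq_apolar_ideal apolar_ideal_def Var_mult weighted_sum_single
        dp_coeff_quadric_product lookup_add lookup_single when_def)
  moreover have "Var X1 ^ 2 - Var X2 ^ 2 \<in> perp (quadric_product :: 'n xy_var mpoly)"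
    by (auto simp: perp_eq_apolar_ideal apolar_ideal_def Var_power weighted_sum_diff weighted_sum_single
        dp_coeff_quadric_product lookup_add lookup_single when_def y)
  moreover have "Var (Y i) * Var (Y j) \<in> perp (quadric_product :: 'n xy_var mpoly)" if "i \<noteq> j" for i j
    using not_y_square_add[OF that]
    by (auto simp: perp_eq_apolar_ideal apolar_ideal_def Var_mult weighted_sum_single
        dp_coeff_quadric_product)
  moreover have "Var (Y i) ^ 2 - Var (Y j) ^ 2 \<in> perp (quadric_product :: 'n xy_var mpoly)" for i j
    by (auto simp: perp_eq_apolar_ideal apolar_ideal_def Var_power weighted_sum_diff weighted_sum_single
        dp_coeff_quadric_product lookup_add lookup_single when_def y_square_add_2)
  ultimately show ?thesis unfolding perp_quadrics_def by blast
qed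

text \<open>
  The identity \<open>x^3 = x (x^2 - y^2) + y (x y)\<close> exhibits the cube of each variable in the ideal of the
  quadrics. For the variables \<open>y_j\<close> a second one is required, which is where \<open>n \<ge> 2\<close> enters.
\<close>

lemma Var_in_radical_of_perp_quadrics:
  assumes R: "is_ideal R" "\<And>x k. x ^ k \<in> R \<Longrightarrow> x \<in> R" "perp_quadrics \<subseteq> R"
    and n: "CARD('n) \<ge> 2"
  shows "Var (v :: 'n::finite xy_var) \<in> R"
proof -
  have cube: "x \<in> R" if "x ^ 2 - y ^ 2 \<in> R" "x * y \<in> R" for x y
  proof -
    have "x * (x ^ 2 - y ^ 2) + y * (x * y) \<in> R"
      using R(1) that unfolding is_ideal_def by blast
    also have "x * (x ^ 2 - y ^ 2) + y * (x * y) = x ^ 3"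
      by (simp add: algebra_simps power2_eq_square power3_eq_cube)
    finally show ?thesis by (rule R(2))
  qed
  have X: "Var X1 * Var X2 \<in> R" "Var X1 ^ 2 - Var X2 ^ 2 \<in> R"
    and YY: "\<And>i j. i \<noteq> j \<Longrightarrow> Var (Y i) * Var (Y j) \<in> R" "\<And>i j. Var (Y i) ^ 2 - Var (Y j) ^ 2 \<in> R"
    using R(3) unfolding perp_quadrics_def by blast+
  show ?thesis
  proof (cases v)
    case X1
    thus ?thesis using cube X by blast
  next
    case X2
    have "Var X2 ^ 2 - Var X1 ^ 2 \<in> R"
      using is_ideal_uminus[OF R(1) X(2)] by simp
    thus ?thesis using cube[of "Var X2" "Var X1"] X(1) X2 by (simp add: mult.commute)
  next
    case (Y i)
    have "\<exists>j. j \<noteq> i"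
    proof (rule ccontr)
      assume "\<not> ?thesis"
      hence "(UNIV :: 'n set) = {i}" by auto
      hence "CARD('n) = 1" by (metis card_1_singleton_iff One_nat_def)
      thus False using n by simp
    qed
    then obtain j where "j \<noteq> i" by blast
    thus ?thesis using cube[OF YY(2)[of i j] YY(1)[of i j]] Y by auto
  qed
qed

lemma is_form_perp_quadrics:
  assumes "g \<in> mpoly.span perp_quadrics" shows "is_form 2 g"
proof -
  have "is_form 2 (Var v * Var w)" for v w :: "'a xy_var"
    using is_form_mult[OF is_form_Var is_form_Var, of v w] by (simp add: numeral_2_eq_2)
  hence 1: "is_form 2 (Var v * Var w)" "is_form 2 (Var v ^ 2)" for v w :: "'a xy_var"
    by (auto simp: power2_eq_square)
  have "perp_quadrics \<subseteq> {p :: 'a xy_var mpoly. is_form 2 p}"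
    unfolding perp_quadrics_def using 1 by (auto intro: is_form_diff)
  thus ?thesis using assms mpoly.span_minimal[OF _ subspace_forms] by blast
qed

text \<open>
  Cubic operators that map the form to 4 times the individual variables. Here \<open>k\<close> is any index; it
  serves to produce a square \<open>y_k^2\<close>.
\<close>

definition dual_cubic :: "'n \<Rightarrow> 'n xy_var \<Rightarrow> 'n::finite xy_var mpoly" where
  "dual_cubic k v = Poly_Mapping.single (case v of
       X1 \<Rightarrow> Poly_Mapping.single X1 1 + Poly_Mapping.single (Y k) 2
     | X2 \<Rightarrow> Poly_Mapping.single X2 1 + Poly_Mapping.single (Y k) 2
     | Y j \<Rightarrow> Poly_Mapping.single X1 2 + Poly_Mapping.single (Y j) 1) 1"

lemma dual_cubic_pairing:
  "weighted_sum (dp_coeff quadric_product) (Var w * dual_cubic k v) = (if v = w then 4 else 0)"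
proof -
  have *: "y_square (Poly_Mapping.single (Y i) 1 + (Poly_Mapping.single X1 2 + Poly_Mapping.single (Y j) 1)) \<longleftrightarrow> i = j"
    for i j :: 'a
  proof (cases "i = j")
    case True
    thus ?thesis by (auto simp: y_square_def lookup_add lookup_single when_def intro!: exI[of _ j])
  next
    case False
    thus ?thesis using not_y_square_add[OF False, of "Poly_Mapping.single X1 2"]
      by (simp add: ac_simps)
  qed
  have y2: "y_square (Poly_Mapping.single w 1 + (Poly_Mapping.single v 1 + Poly_Mapping.single (Y k) 2))"
    if "w \<in> {X1, X2}" "v \<in> {X1, X2}" for w v and k :: 'a
    using that by (auto simp: y_square_def lookup_add lookup_single when_def intro!: exI[of _ k])
  show ?thesis
    using y2[of w v k]
    by (cases v; cases w)
      (auto simp: dual_cubic_def mult_single Var_def weighted_sum_single dp_coeff_quadric_product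
        lookup_add lookup_single when_def *[simplified])
qed

lemma is_form_dual_cubic: "is_form 3 (dual_cubic k v)"
  by (cases v)
    (auto simp: dual_cubic_def mdeg_add mdeg_single intro!: is_form_single)

section \<open>The lower bound on the cactus rank\<close>

text \<open>
  No nonzero first order derivation kills the form, since each coefficient of the derivation can be read
  off by pairing with \<open>dual_cubic\<close>.
\<close>

lemma linear_form_in_perp:
  fixes c :: "'n::finite xy_var \<Rightarrow> complex"
  assumes "(\<Sum>v\<in>UNIV. smul (c v) (Var v)) \<in> perp quadric_product"
  shows "c v = 0"
proof -
  have "0 = weighted_sum (dp_coeff quadric_product) (dual_cubic k v * (\<Sum>w\<in>UNIV. smul (c w) (Var w)))" for k
    using assms unfolding perp_eq_apolar_ideal by (simp add: apolar_idealD)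
  also have "\<dots> k = (\<Sum>w\<in>UNIV. c w * (if v = w then 4 else 0))" for k
    by (simp add: sum_distrib_left smul_mult weighted_sum_sum weighted_sum_smul mult.commute[of "dual_cubic k v"]
        dual_cubic_pairing)
  finally show ?thesis by (simp add: if_distrib cong: if_cong)
qed

text \<open>
  The \<open>2 (n + 2)\<close> independent cubics are the multiples of a nonzerodivisor \<open>g\<close> by the variables and the
  cubics \<open>dual_cubic\<close>. Applying a relation modulo \<open>I\<close> to the form kills the multiples of \<open>g\<close>, so the
  coefficients of the dual cubics vanish. What is left is a multiple of \<open>g\<close> by a linear form, so
  this linear form lies in \<open>I\<close> and must be zero.
\<close>

lemma hilbert_function_3_ge:
  fixes I :: "'n::finite xy_var mpoly set"
  assumes I: "is_ideal I" "saturated I" "I \<subseteq> perp quadric_product" and n: "CARD('n) \<ge> 2"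
  shows "2 * CARD('n) + 4 \<le> hilbert_function I 3"
proof -
  obtain g where g: "g \<in> mpoly.span perp_quadrics" "\<And>p. g * p \<in> I \<Longrightarrow> p \<in> I"
    by (rule exists_nonzerodivisor[OF I(1,2) finite_perp_quadrics])
      (use Var_in_radical_of_perp_quadrics[OF _ _ _ n] in blast)+
  have perp: "is_ideal (perp (quadric_product :: 'n xy_var mpoly))"
    unfolding perp_eq_apolar_ideal by (rule is_ideal_apolar_ideal)
  have g_perp: "g \<in> perp quadric_product"
    using g(1) perp_quadrics_subset_perp mpoly.span_minimal[OF _ subspace_ideal[OF perp]] by blast
  fix k :: 'n
  define e :: "bool \<times> 'n xy_var \<Rightarrow> 'n xy_var mpoly" where
    "e = (\<lambda>(s, v). if s then g * Var v else dual_cubic k v)"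
  have "card (UNIV :: (bool \<times> 'n xy_var) set) \<le> hilbert_function I 3"
  proof (rule hilbert_function_ge[OF I(1), where e = e])
    fix j
    show "is_form 3 (e j)"
      using is_form_mult[OF is_form_perp_quadrics[OF g(1)] is_form_Var, of "snd j"]
      by (cases j) (auto simp: e_def is_form_dual_cubic)
  next
    fix c :: "bool \<times> 'n xy_var \<Rightarrow> complex"
    assume *: "(\<Sum>j\<in>UNIV. smul (c j) (e j)) \<in> I"
    define l where "l = (\<Sum>v\<in>UNIV. smul (c (True, v)) (Var v))"
    define h where "h = (\<Sum>v\<in>UNIV. smul (c (False, v)) (dual_cubic k v))"
    have "(\<Sum>j\<in>UNIV. smul (c j) (e j)) = (\<Sum>s\<in>UNIV. \<Sum>v\<in>UNIV. smul (c (s, v)) (e (s, v)))"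
      by (simp add: sum.cartesian_product)
    also have "\<dots> = g * l + h"
      by (simp add: UNIV_bool e_def l_def h_def sum_distrib_left smul_mult)
    finally have gl: "g * l + h \<in> I" using * by simp
    have "l * g \<in> perp quadric_product"
      by (rule is_ideal_mult[OF perp g_perp])
    hence "(g * l + h) + - (l * g) \<in> perp quadric_product"
      using gl I(3) is_ideal_uminus[OF perp] perp unfolding is_ideal_def by blast
    hence h: "h \<in> perp quadric_product"
      by (simp add: mult.commute)
    have c0: "c (False, w) = 0" for w
    proof -
      have "0 = weighted_sum (dp_coeff quadric_product) (Var w * h)"
        using h unfolding perp_eq_apolar_ideal by (simp add: apolar_idealD)
      also have "\<dots> = (\<Sum>v\<in>UNIV. c (False, v) * (if v = w then 4 else 0))"
        by (simp add: h_def sum_distrib_left smul_mult weighted_sum_sum weighted_sum_smul dual_cubic_pairing)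
      finally show ?thesis by (simp add: if_distrib cong: if_cong)
    qed
    hence "h = 0" by (simp add: h_def)
    hence "l \<in> perp quadric_product"
      using gl g(2) I(3) by auto
    hence "c (True, w) = 0" for w
      unfolding l_def by (rule linear_form_in_perp)
    with c0 show "\<forall>j\<in>UNIV. c j = 0" by (metis (full_types) prod.exhaust)
  qed simp
  thus ?thesis by (simp add: card_xy_var card_prod)
qed

lemma zero_dim_subscheme_hilbert_function_le:
  fixes I :: "'v::finite mpoly set"
  assumes "zero_dim_subscheme I r"
  shows "hilbert_function I d \<le> r"
proof -
  have I: "is_ideal I" "saturated I"
    using assms by (auto simp: zero_dim_subscheme_def homogeneous_ideal_def)
  obtain l where l: "l \<in> mpoly.span (range (Var :: 'v \<Rightarrow> _))" "\<And>p. l * p \<in> I \<Longrightarrow> p \<in> I"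
    by (rule exists_nonzerodivisor[OF I, of "range Var"]) auto
  have "is_form 1 l"
    using l(1) mpoly.span_minimal[OF _ subspace_forms, of "range Var" 1] is_form_Var by blast
  hence "hilbert_function I d \<le> hilbert_function I (1 + d)" for d
    using l(2) by (rule hilbert_function_mono_mult[OF I(1)])
  hence mono: "hilbert_function I d \<le> hilbert_function I (d + k)" for k
    by (induction k) (auto intro: order_trans)
  obtain N where "\<And>d. d \<ge> N \<Longrightarrow> hilbert_function I d = r"
    using assms by (auto simp: zero_dim_subscheme_def eventually_sequentially)
  with mono[of N] show ?thesis by simp
qed

lemma cactus_rank_ge:
  assumes "CARD('n::finite) \<ge> 2"
  shows "enat (2 * CARD('n) + 4) \<le> cactus_rank (quadric_product :: 'n xy_var mpoly)"
  unfolding cactus_rank_def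
proof (rule Inf_greatest, safe)
  fix r and I :: "'n xy_var mpoly set"
  assume I: "zero_dim_subscheme I r" "I \<subseteq> perp quadric_product"
  have "2 * CARD('n) + 4 \<le> hilbert_function I 3"
    using I assms by (intro hilbert_function_3_ge) (auto simp: zero_dim_subscheme_def homogeneous_ideal_def)
  also have "\<dots> \<le> r"
    by (rule zero_dim_subscheme_hilbert_function_le[OF I(1)])
  finally show "enat (2 * CARD('n) + 4) \<le> enat r" by simp
qed

section \<open>The upper bound on the cactus rank\<close>

lemma weighted_sum_hom_part:
  "weighted_sum f (hom_part d p) = weighted_sum (\<lambda>m. if mdeg m = d then f m else 0) p"
proof -
  have "weighted_sum f (hom_part d p) =
      (\<Sum>m | m \<in> Poly_Mapping.keys p \<and> mdeg m = d. f m * Poly_Mapping.lookup p m)"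
    by (simp add: hom_part_def weighted_sum_sum weighted_sum_single)
  also have "\<dots> = weighted_sum (\<lambda>m. if mdeg m = d then f m else 0) p"
    unfolding weighted_sum_def by (intro sum.mono_neutral_cong_left) auto
  finally show ?thesis .
qed

definition in_degree :: "nat \<Rightarrow> ('v::finite monom \<Rightarrow> complex) \<Rightarrow> 'v monom \<Rightarrow> complex" where
  "in_degree k f m = (if mdeg m = k then f m else 0)"

text \<open>
  The homogeneous version of \<open>apolar_ideal\<close>: the functional is restricted to each degree separately. If \<open>f\<close>
  comes from a power series \<open>S\<close> in divided powers, this is the ideal of the operators that kill
  every homogeneous component of \<open>S\<close>.
\<close>

definition graded_apolar_ideal :: "('v::finite monom \<Rightarrow> complex) \<Rightarrow> 'v mpoly set" where
  "graded_apolar_ideal f = (\<Inter>k. apolar_ideal (in_degree k f))"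

lemma is_ideal_graded_apolar_ideal: "is_ideal (graded_apolar_ideal f)"
  using is_ideal_apolar_ideal[of "in_degree _ f"]
  unfolding graded_apolar_ideal_def is_ideal_def by blast

text \<open>
  When the functional lives in degree \<open>k\<close>, a monomial multiplier of degree \<open>e\<close> sees only the component of
  degree \<open>k - e\<close> of its argument.
\<close>

lemma homogeneous_graded_apolar_ideal: "homogeneous_ideal (graded_apolar_ideal f)"
  unfolding homogeneous_ideal_def
proof (intro conjI ballI allI is_ideal_graded_apolar_ideal)
  fix p d assume p: "p \<in> graded_apolar_ideal f"
  have "weighted_sum (\<lambda>a. in_degree k f (m + a)) (hom_part d p) = 0" for k m
  proof (cases "mdeg m + d = k")
    case True
    hence "weighted_sum (\<lambda>a. in_degree k f (m + a)) (hom_part d p) =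
        weighted_sum (\<lambda>a. in_degree k f (m + a)) p"
      by (auto simp: weighted_sum_hom_part in_degree_def mdeg_add intro!: arg_cong2[where f = weighted_sum])
    also have "\<dots> = 0"
      using p by (auto simp: graded_apolar_ideal_def apolar_ideal_def)
    finally show ?thesis .
  next
    case False
    hence "(\<lambda>a. if mdeg a = d then in_degree k f (m + a) else 0) = (\<lambda>_. 0)"
      by (auto simp: in_degree_def mdeg_add)
    thus ?thesis
      unfolding weighted_sum_hom_part by (simp add: weighted_sum_def)
  qed
  thus "hom_part d p \<in> graded_apolar_ideal f"
    by (auto simp: graded_apolar_ideal_def apolar_ideal_def)
qed

text \<open>
  The hypothesis says that multiplication by \<open>U\<close> is compatible with the functionals of consecutive degrees,
  so that \<open>U\<close> is invertible in the dual space, and powers of \<open>U\<close> may be cancelled.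
\<close>

lemma saturated_graded_apolar_ideal:
  assumes U: "is_form 1 U" "\<And>k q. weighted_sum (in_degree (Suc k) f) (U * q) = weighted_sum (in_degree k f) q"
  shows "saturated (graded_apolar_ideal f)"
  unfolding saturated_def
proof safe
  fix p k assume *: "\<forall>g. is_form k g \<longrightarrow> g * p \<in> graded_apolar_ideal f"
  have shift: "weighted_sum (in_degree (K + k) f) (U ^ k * q) = weighted_sum (in_degree K f) q" for K q
  proof (induction k arbitrary: q)
    case (Suc k)
    show ?case using U(2) by (simp add: mult.assoc Suc.IH)
  qed simp
  have "is_form k (U ^ k)"
    using is_form_power[OF U(1), of k] by simp
  hence Up: "U ^ k * p \<in> apolar_ideal (in_degree K f)" for K
    using * by (auto simp: graded_apolar_ideal_def)
  have "weighted_sum (in_degree K f) (h * p) = 0" for K h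
  proof -
    have "weighted_sum (in_degree K f) (h * p) = weighted_sum (in_degree (K + k) f) (h * (U ^ k * p))"
      using shift[of K "h * p"] by (simp only: mult.left_commute)
    also have "\<dots> = 0"
      by (rule apolar_idealD[OF Up])
    finally show ?thesis .
  qed
  thus "p \<in> graded_apolar_ideal f"
    by (simp add: graded_apolar_ideal_def apolar_ideal_iff)
qed

lemma weighted_sum_in_degree_form:
  assumes "is_form d p"
  shows "weighted_sum (\<lambda>a. in_degree k f (m + a)) p =
    (if mdeg m + d = k then weighted_sum (\<lambda>a. f (m + a)) p else 0)"
  using assms by (auto simp: is_form_def weighted_sum_def in_degree_def mdeg_add intro!: sum.neutral sum.cong)

lemma form_in_graded_apolar_ideal_iff:
  assumes "is_form d p"
  shows "p \<in> graded_apolar_ideal f \<longleftrightarrow> (\<forall>m. weighted_sum (\<lambda>a. f (m + a)) p = 0)"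
  using assms by (auto simp: graded_apolar_ideal_def apolar_ideal_def weighted_sum_in_degree_form)

text \<open>
  Indexes the basis \<open>1, y_j, p\<close> of the space of derivatives of \<open>p = y_1^2 + ... + y_n^2\<close>: \<open>None\<close> stands
  for the constant 1, \<open>Some (Some j)\<close> for \<open>y_j\<close> and \<open>Some None\<close> for \<open>p\<close>. The type has \<open>n + 2\<close> elements.
\<close>

type_synonym 'n y_index = "'n option option"

text \<open>
  The functionals on polynomials in the \<open>y_j\<close> given, up to scaling, by pairing with \<open>1\<close>, \<open>y_j\<close> and \<open>p\<close>; the
  argument \<open>f\<close> is the exponent of a monomial.
\<close>

fun y_indicator :: "'n y_index \<Rightarrow> ('n \<Rightarrow> nat) \<Rightarrow> complex" where
  "y_indicator None f = (if f = (\<lambda>_. 0) then 1 else 0)"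
| "y_indicator (Some (Some j)) f = (if f = (\<lambda>i. if i = j then 1 else 0) then 1 else 0)"
| "y_indicator (Some None) f = (if \<exists>j. f = (\<lambda>i. if i = j then 2 else 0) then 1 else 0)"

definition y_exp :: "'n xy_var monom \<Rightarrow> 'n \<Rightarrow> nat" where
  "y_exp m j = Poly_Mapping.lookup m (Y j)"

text \<open>
  The value of the monomial \<open>x1^a x2^b\<close> at the point \<open>(1, i)\<close>. This point is the support of the scheme.
\<close>

definition x_char :: "'n xy_var monom \<Rightarrow> complex" where
  "x_char m = \<i> ^ Poly_Mapping.lookup m X2"

text \<open>
  The logarithmic derivative of \<open>x1^a x2^b\<close> at \<open>(1, i)\<close> in the direction \<open>(1, -i)\<close>. So \<open>x_char m * x_deriv m\<close>
  is a derivative, and \<open>x_deriv\<close> is additive. In terms of forms, \<open>x_char\<close> is the pairing with the divided power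
  of \<open>u = x1 + i x2\<close> and \<open>x_char m * x_deriv m\<close> the pairing with a divided power of \<open>u\<close> times
  \<open>v = x1 - i x2\<close>.
\<close>

definition x_deriv :: "'n xy_var monom \<Rightarrow> complex" where
  "x_deriv m = of_nat (Poly_Mapping.lookup m X1) - of_nat (Poly_Mapping.lookup m X2)"

text \<open>
  These \<open>2 (n + 2)\<close> functionals form a basis of the dual of the coordinate ring of the scheme: pairing
  with \<open>u^k\<close> or \<open>u^k v\<close> times \<open>1\<close>, \<open>y_j\<close> or \<open>p\<close>, up to scaling.
\<close>

definition functional :: "bool \<times> 'n y_index \<Rightarrow> 'n xy_var monom \<Rightarrow> complex" where
  "functional = (\<lambda>(s, t) m. x_char m * (if s then x_deriv m else 1) * y_indicator t (y_exp m))"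

text \<open>
  Pairing with \<open>u^k v p\<close>, up to scaling, from which the other functionals arise by differentiation. In
  degree 4 it is the pairing with a multiple of the form itself.
\<close>

definition socle_functional :: "'n xy_var monom \<Rightarrow> complex" where
  "socle_functional = functional (True, Some None)"

text \<open>
  The perfect pairing of the basis \<open>1, y_j, p\<close> with itself: \<open>1\<close> and \<open>p\<close> are dual to each other and each
  \<open>y_j\<close> is dual to itself.
\<close>

fun dual_index :: "'n y_index \<Rightarrow> 'n y_index" where
  "dual_index None = Some None"
| "dual_index (Some None) = None"
| "dual_index (Some (Some j)) = Some (Some j)"

lemma x_char_add: "x_char (m + m') = x_char m * x_char m'"
  by (simp add: x_char_def lookup_add power_add)

lemma x_deriv_add: "x_deriv (m + m') = x_deriv m + x_deriv m'"
  by (simp add: x_deriv_def lookup_add)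

lemma y_exp_add: "y_exp (m + m') j = y_exp m j + y_exp m' j"
  by (simp add: y_exp_def lookup_add)

text \<open>
  A monomial on which the functional indexed by \<open>t\<close> takes the value 1 and all the others vanish. For the
  quadric \<open>p\<close> any square \<open>y_k^2\<close> will do.
\<close>

definition y_monom :: "'n \<Rightarrow> 'n y_index \<Rightarrow> 'n xy_var monom" where
  "y_monom k t = (case t of None \<Rightarrow> 0 | Some None \<Rightarrow> Poly_Mapping.single (Y k) 2
     | Some (Some j) \<Rightarrow> Poly_Mapping.single (Y j) 1)"

lemma y_exp_y_monom:
  "y_exp (y_monom k t) = (case t of None \<Rightarrow> (\<lambda>_. 0) | Some None \<Rightarrow> (\<lambda>i. if i = k then 2 else 0)
     | Some (Some j) \<Rightarrow> (\<lambda>i. if i = j then 1 else 0))"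
  by (auto simp: y_exp_def y_monom_def lookup_single when_def fun_eq_iff split: option.splits)

lemma y_indicator_dual:
  "y_indicator (Some None) (\<lambda>j. y_exp (y_monom k (dual_index t)) j + f j) = y_indicator t f"
proof (cases t rule: dual_index.cases)
  case 1
  have "(\<exists>j. (\<lambda>i. (if i = k then 2 else 0) + f i) = (\<lambda>i. if i = j then 2 else 0)) \<longleftrightarrow> f = (\<lambda>_. 0)"
  proof
    assume "\<exists>j. (\<lambda>i. (if i = k then 2 else 0) + f i) = (\<lambda>i. if i = j then 2 else 0)"
    then obtain j where j: "(\<lambda>i. (if i = k then 2 else 0) + f i) = (\<lambda>i. if i = j then 2 else 0)" ..
    have "k = j" using fun_cong[OF j, of k] by (auto split: if_splits)
    have "f i = 0" for i
      using fun_cong[OF j, of i] \<open>k = j\<close> by (auto split: if_splits)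
    thus "f = (\<lambda>_. 0)" by blast
  qed (auto intro!: exI[of _ k])
  thus ?thesis using 1 by (simp add: y_exp_y_monom)
next
  case 2
  thus ?thesis by (simp add: y_exp_y_monom)
next
  case (3 l)
  have "(\<exists>j. (\<lambda>i. (if i = l then 1 else 0) + f i) = (\<lambda>i. if i = j then 2 else 0)) \<longleftrightarrow>
      f = (\<lambda>i. if i = l then 1 else 0)"
  proof
    assume "\<exists>j. (\<lambda>i. (if i = l then 1 else 0) + f i) = (\<lambda>i. if i = j then 2 else 0)"
    then obtain j where j: "(\<lambda>i. (if i = l then 1 else 0) + f i) = (\<lambda>i. if i = j then 2 else 0)" ..
    have "l = j" using fun_cong[OF j, of l] by (auto split: if_splits)
    have "f i = (if i = l then 1 else 0)" for i
      using fun_cong[OF j, of i] \<open>l = j\<close> by (auto split: if_splits)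
    thus "f = (\<lambda>i. if i = l then 1 else 0)" by blast
  qed (auto intro!: exI[of _ l])
  thus ?thesis using 3 by (simp add: y_exp_y_monom)
qed

text \<open>
  Differentiating \<open>p\<close> by a monomial gives a multiple of a basis element \<open>1, y_j, p\<close> or zero.
\<close>

lemma y_indicator_add:
  fixes g :: "'n \<Rightarrow> nat"
  shows "(\<exists>t. \<forall>f. y_indicator (Some None) (\<lambda>j. g j + f j) = y_indicator t f) \<or>
   (\<forall>f. y_indicator (Some None) (\<lambda>j. g j + f j) = 0)"
proof (cases "\<exists>f j. (\<lambda>i. g i + f i) = (\<lambda>i. if i = j then 2 else 0)")
  case True
  then obtain f j where fj: "\<And>i. g i + f i = (if i = j then 2 else 0)" by (metis fun_cong)
  have "g i = 0" if "i \<noteq> j" for i using fj[of i] that by simp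
  hence "g = (\<lambda>i. if i = j then g j else 0)"
    by (auto simp: fun_eq_iff)
  moreover have "g j = 0 \<or> g j = 1 \<or> g j = 2" using fj[of j] by auto
  ultimately have "g = (\<lambda>_. 0) \<or> g = (\<lambda>i. if i = j then 1 else 0) \<or> g = (\<lambda>i. if i = j then 2 else 0)"
    by (metis (mono_tags))
  hence "\<exists>t. g = y_exp (y_monom j (dual_index t))"
  proof (elim disjE)
    assume "g = (\<lambda>_. 0)"
    thus ?thesis by (intro exI[of _ "Some None"]) (simp add: y_exp_y_monom)
  next
    assume "g = (\<lambda>i. if i = j then 1 else 0)"
    thus ?thesis by (intro exI[of _ "Some (Some j)"]) (simp add: y_exp_y_monom)
  next
    assume "g = (\<lambda>i. if i = j then 2 else 0)"
    thus ?thesis by (intro exI[of _ None]) (simp add: y_exp_y_monom)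
  qed
  then obtain t where "g = y_exp (y_monom j (dual_index t))" ..
  thus ?thesis using y_indicator_dual[of j t] by blast
qed simp

lemma socle_functional_add:
  assumes "\<And>f. y_indicator (Some None) (\<lambda>j. y_exp m j + f j) = y_indicator t f"
  shows "socle_functional (m + a) =
    x_char m * functional (True, t) a + (x_char m * x_deriv m) * functional (False, t) a"
proof -
  have "y_indicator (Some None) (y_exp (m + a)) = y_indicator t (y_exp a)"
    using assms[of "y_exp a"] by (simp add: y_exp_add[abs_def])
  thus ?thesis
    by (simp add: socle_functional_def functional_def x_char_add x_deriv_add algebra_simps
        del: y_indicator.simps)
qed

text \<open>
  All the derivatives of the socle functional are combinations of the \<open>functional s\<close>.
\<close>

lemma form_in_socle_ideal_if:
  assumes "is_form d p" "\<And>s. weighted_sum (functional s) p = 0"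
  shows "p \<in> graded_apolar_ideal socle_functional"
  unfolding form_in_graded_apolar_ideal_iff[OF assms(1)]
proof
  fix m :: "'a xy_var monom"
  from y_indicator_add[of "y_exp m"] show "weighted_sum (\<lambda>a. socle_functional (m + a)) p = 0"
  proof
    assume "\<exists>t. \<forall>f. y_indicator (Some None) (\<lambda>j. y_exp m j + f j) = y_indicator t f"
    then obtain t where t: "\<And>f. y_indicator (Some None) (\<lambda>j. y_exp m j + f j) = y_indicator t f" by blast
    show ?thesis
      using assms(2) by (simp add: socle_functional_add[OF t] weighted_sum_lincomb)
  next
    assume *: "\<forall>f. y_indicator (Some None) (\<lambda>j. y_exp m j + f j) = 0"
    have "y_indicator (Some None) (y_exp (m + a)) = 0" for a
      using *[rule_format, of "y_exp a"] by (simp add: y_exp_add[abs_def])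
    thus ?thesis
      by (simp add: socle_functional_def functional_def weighted_sum_def del: y_indicator.simps)
  qed
qed

lemma mdeg_y_monom: "mdeg (y_monom k t) = (case t of None \<Rightarrow> 0 | Some None \<Rightarrow> 2 | Some (Some j) \<Rightarrow> 1)"
  by (auto simp: y_monom_def mdeg_single split: option.splits)

lemma lookup_y_monom [simp]: "Poly_Mapping.lookup (y_monom k t) X1 = 0" "Poly_Mapping.lookup (y_monom k t) X2 = 0"
  by (auto simp: y_monom_def lookup_single split: option.splits)

lemma if_fun_eq_iff:
  fixes c d :: nat
  assumes "c > 0"
  shows "(\<lambda>i. if i = j then c else 0) = (\<lambda>i. if i = k then d else 0) \<longleftrightarrow> j = k \<and> c = d"
proof
  assume *: "(\<lambda>i. if i = j then c else 0) = (\<lambda>i. if i = k then d else 0)"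
  from fun_cong[OF *, of j] assms show "j = k \<and> c = d" by (auto split: if_splits)
qed auto

lemma if_fun_neq_0:
  fixes c :: nat
  assumes "c > 0"
  shows "(\<lambda>i. if i = j then c else 0) \<noteq> (\<lambda>_. 0)" "(\<lambda>_. 0) \<noteq> (\<lambda>i. if i = j then c else 0)"
  using assms by (metis less_numeral_extra(3))+

lemma y_indicator_y_monom: "y_indicator s (y_exp (y_monom k t)) = (if s = t then 1 else 0)"
  by (cases s; cases t; cases "the s"; cases "the t")
    (auto simp: y_exp_y_monom if_fun_eq_iff if_fun_neq_0)

text \<open>
  Conversely each \<open>functional (s, t)\<close> is a combination of derivatives of the socle functional. The monomial
  \<open>y_monom k (dual_index t)\<close> produces \<open>functional (True, t)\<close>, and an additional factor \<open>x1\<close>, on which both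
  \<open>x_char\<close> and \<open>x_deriv\<close> are 1, adds \<open>functional (False, t)\<close>.
\<close>

lemma functional_eq_0_if:
  fixes p :: "'n::finite xy_var mpoly"
  assumes "is_form d p" "p \<in> graded_apolar_ideal socle_functional"
  shows "weighted_sum (functional (s, t)) p = 0"
proof -
  fix k :: 'n
  let ?m = "y_monom k (dual_index t)"
  note zero = assms(2)[unfolded form_in_graded_apolar_ideal_iff[OF assms(1)], rule_format]
  have "weighted_sum (functional (True, t)) p = 0"
    using zero[of ?m]
    by (simp add: socle_functional_add[OF y_indicator_dual] weighted_sum_lincomb x_char_def x_deriv_def)
  moreover have "y_exp (?m + Poly_Mapping.single X1 1) = y_exp ?m"
    by (simp add: y_exp_def fun_eq_iff lookup_add lookup_single)
  hence "socle_functional (?m + Poly_Mapping.single X1 1 + a) = 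
      functional (True, t) a + functional (False, t) a" for a
    by (subst socle_functional_add[where t = t])
      (simp_all only: y_indicator_dual, simp add: x_char_def x_deriv_def lookup_add lookup_single)
  with zero[of "?m + Poly_Mapping.single X1 1"]
  have "weighted_sum (functional (True, t)) p + weighted_sum (functional (False, t)) p = 0"
    using weighted_sum_lincomb[of 1 "functional (True, t)" 1 "functional (False, t)" p] by simp
  ultimately show ?thesis by (cases s) auto
qed

text \<open>
  The forms of degree \<open>d\<close> dual to the functionals. For an exponent \<open>N\<close> of the \<open>x\<close>-part, the values of
  (\<open>x_char\<close>, \<open>x_char * x_deriv\<close>) are \<open>(1, N)\<close> on \<open>x1^N\<close> and \<open>(-1, 2 - N)\<close> on \<open>i x1^(N-1) x2\<close>. So \<open>q\<close>, half
  of their sum, has the values \<open>(0, 1)\<close>, and \<open>x1^N - N q\<close> has the values \<open>(1, 0)\<close>.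
\<close>

definition dual_form :: "'n::finite \<Rightarrow> nat \<Rightarrow> bool \<times> 'n y_index \<Rightarrow> 'n xy_var mpoly" where
  "dual_form k d = (\<lambda>(s, t).
     let N = d - mdeg (y_monom k t);
         p = Poly_Mapping.single (Poly_Mapping.single X1 N + y_monom k t) 1;
         q = smul (1 / 2) (p + Poly_Mapping.single (Poly_Mapping.single X1 (N - 1) + Poly_Mapping.single X2 1 + y_monom k t) \<i>)
     in if s then q else p - smul (of_nat N) q)"

lemma functional_single:
  "weighted_sum (functional (s, t)) (Poly_Mapping.single
      (Poly_Mapping.single X1 a + Poly_Mapping.single X2 b + y_monom k t') c) =
    (if t = t' then c * \<i> ^ b * (if s then of_nat a - of_nat b else 1) else 0)"
proof -
  have "y_exp (Poly_Mapping.single X1 a + Poly_Mapping.single X2 b + y_monom k t') = y_exp (y_monom k t')"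
    by (simp add: y_exp_def fun_eq_iff lookup_add lookup_single)
  thus ?thesis
    by (simp add: weighted_sum_single functional_def y_indicator_y_monom x_char_def x_deriv_def
        lookup_add lookup_single del: y_indicator.simps)
qed

lemma functional_dual_form:
  fixes k :: "'n::finite"
  assumes "d \<ge> 3"
  shows "weighted_sum (functional s) (dual_form k d r) = (if s = r then 1 else 0)"
proof -
  obtain s1 s2 r1 r2 where sr: "s = (s1, s2)" "r = (r1, r2)" by (cases s; cases r)
  define N where "N = d - mdeg (y_monom k r2)"
  have "mdeg (y_monom k r2) \<le> 2" by (auto simp: mdeg_y_monom split: option.splits)
  hence N: "N \<ge> 1" using assms by (simp add: N_def)
  define p where "p = Poly_Mapping.single (Poly_Mapping.single X1 N + y_monom k r2) (1 :: complex)"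
  define q where "q = Poly_Mapping.single
    (Poly_Mapping.single X1 (N - 1) + Poly_Mapping.single X2 1 + y_monom k r2) \<i>"
  have p: "weighted_sum (functional s) p = (if s2 = r2 then if s1 then of_nat N else 1 else 0)"
    using functional_single[of s1 s2 N 0 k r2 1] by (simp add: p_def sr)
  have q: "weighted_sum (functional s) q = (if s2 = r2 then if s1 then 2 - of_nat N else - 1 else 0)"
    using functional_single[of s1 s2 "N - 1" 1 k r2 \<i>] N by (simp add: q_def sr of_nat_diff)
  have "dual_form k d r = (if r1 then smul (1 / 2) (p + q) else p - smul (of_nat N) (smul (1 / 2) (p + q)))"
    by (simp add: sr dual_form_def Let_def N_def p_def q_def)
  hence "weighted_sum (functional s) (dual_form k d r) = (if r1
      then 1 / 2 * (weighted_sum (functional s) p + weighted_sum (functional s) q)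
      else weighted_sum (functional s) p -
        of_nat N * (1 / 2 * (weighted_sum (functional s) p + weighted_sum (functional s) q)))"
    by (simp only: weighted_sum_diff weighted_sum_add weighted_sum_smul split: if_split) simp
  also have "\<dots> = (if s = r then 1 else 0)"
    unfolding p q by (auto simp: sr)
  finally show ?thesis .
qed

lemma is_form_dual_form:
  fixes k :: "'n::finite"
  assumes "d \<ge> 3"
  shows "is_form d (dual_form k d r)"
proof -
  obtain s t where r: "r = (s, t)" by (cases r)
  define N where "N = d - mdeg (y_monom k t)"
  have "mdeg (y_monom k t) \<le> 2" by (auto simp: mdeg_y_monom split: option.splits)
  hence N: "N \<ge> 1" "N + mdeg (y_monom k t) = d" using assms by (simp_all add: N_def)
  define p where "p = Poly_Mapping.single (Poly_Mapping.single X1 N + y_monom k t) (1 :: complex)"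
  define q where "q = Poly_Mapping.single
    (Poly_Mapping.single X1 (N - 1) + Poly_Mapping.single X2 1 + y_monom k t) \<i>"
  have "is_form d p" "is_form d q"
    unfolding p_def q_def using N by (auto intro!: is_form_single simp: mdeg_add mdeg_single)
  moreover have "dual_form k d r = (if s then smul (1 / 2) (p + q) else p - smul (of_nat N) (smul (1 / 2) (p + q)))"
    by (simp add: r dual_form_def Let_def N_def p_def q_def)
  ultimately show ?thesis
    by (auto intro!: is_form_diff is_form_smul is_form_add simp del: mpoly.scale_scale)
qed

text \<open>
  In degree at least 3 the ideal consists of the common zeros of the \<open>2 (n + 2)\<close> functionals, and the dual
  forms show that these are independent. The bound 3 leaves room for \<open>u^(d-3) v p\<close>.
\<close>

lemma hilbert_function_socle_ideal:
  assumes d: "d \<ge> 3"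
  shows "hilbert_function (graded_apolar_ideal (socle_functional :: 'n::finite xy_var monom \<Rightarrow> _)) d =
    2 * CARD('n) + 4"
proof -
  fix k :: 'n
  let ?I = "graded_apolar_ideal (socle_functional :: 'n xy_var monom \<Rightarrow> _)"
  let ?J = "UNIV :: (bool \<times> 'n y_index) set"
  have sum: "weighted_sum (functional s) (\<Sum>j\<in>?J. smul (c j) (dual_form k d j)) = c s" for c s
    by (simp add: weighted_sum_sum weighted_sum_smul functional_dual_form[OF d] if_distrib cong: if_cong)
  have "card ?J \<le> hilbert_function ?I d"
  proof (rule hilbert_function_ge[OF is_ideal_graded_apolar_ideal, where e = "dual_form k d"])
    fix c assume "(\<Sum>j\<in>?J. smul (c j) (dual_form k d j)) \<in> ?I"
    moreover have "is_form d (\<Sum>j\<in>?J. smul (c j) (dual_form k d j))"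
      by (intro is_form_sum is_form_smul is_form_dual_form d)
    ultimately have "weighted_sum (functional s) (\<Sum>j\<in>?J. smul (c j) (dual_form k d j)) = 0" for s
      using functional_eq_0_if by (cases s) blast
    thus "\<forall>j\<in>?J. c j = 0" by (simp add: sum)
  qed (auto intro: is_form_dual_form d)
  moreover have "hilbert_function ?I d \<le> card ?J"
  proof (rule hilbert_function_le[where e = "dual_form k d"])
    fix p :: "'n xy_var mpoly" assume p: "is_form d p"
    define c where "c s = weighted_sum (functional s) p" for s
    let ?r = "p - (\<Sum>j\<in>?J. smul (c j) (dual_form k d j))"
    have r: "is_form d ?r"
      by (intro is_form_diff p is_form_sum is_form_smul is_form_dual_form d)
    have "weighted_sum (functional s) ?r = 0" for s
      by (simp only: weighted_sum_diff sum) (simp add: c_def)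
    hence "?r \<in> ?I"
      by (rule form_in_socle_ideal_if[OF r])
    with r show "\<exists>c. p - (\<Sum>j\<in>?J. smul (c j) (dual_form k d j)) \<in> ?I \<and>
        is_form d (p - (\<Sum>j\<in>?J. smul (c j) (dual_form k d j)))" by blast
  qed simp
  ultimately show ?thesis by (simp add: card_prod card_option)
qed

text \<open>
  The element \<open>U\<close> is the derivation that is 1 on \<open>u = x1 + i x2\<close> and 0 on \<open>v = x1 - i x2\<close>. It takes the
  divided power of \<open>u\<close> of exponent \<open>k + 1\<close> to the one of exponent \<open>k\<close>.
\<close>

lemma saturated_socle_ideal: "saturated (graded_apolar_ideal (socle_functional :: 'n::finite xy_var monom \<Rightarrow> _))"
proof (rule saturated_graded_apolar_ideal)
  let ?U = "smul (1 / 2) (Var X1) + smul (- \<i> / 2) (Var X2) :: 'n xy_var mpoly"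
  show "is_form 1 ?U"
    by (intro is_form_add is_form_smul is_form_Var)
  fix k and q :: "'n xy_var mpoly"
  let ?f = "in_degree (Suc k) (socle_functional :: 'n xy_var monom \<Rightarrow> _)"
  have y: "y_exp (Poly_Mapping.single X1 1 + m) = y_exp m" "y_exp (Poly_Mapping.single X2 1 + m) = y_exp m" 
    for m :: "'n xy_var monom"
    by (simp_all add: y_exp_def fun_eq_iff lookup_add lookup_single)
  have "1 / 2 * ?f (Poly_Mapping.single X1 1 + m) + (- \<i> / 2) * ?f (Poly_Mapping.single X2 1 + m) =
      in_degree k socle_functional m" for m
    unfolding in_degree_def mdeg_add mdeg_single socle_functional_def functional_def case_prod_conv
      x_char_add x_deriv_add y
    by (simp add: x_char_def x_deriv_def lookup_single algebra_simps del: y_indicator.simps)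
  moreover have "weighted_sum ?f (?U * q) =
      weighted_sum (\<lambda>m. 1 / 2 * ?f (Poly_Mapping.single X1 1 + m) + (- \<i> / 2) * ?f (Poly_Mapping.single X2 1 + m)) q"
    unfolding weighted_sum_lincomb
    by (simp only: distrib_right smul_mult weighted_sum_add weighted_sum_smul Var_def
        weighted_sum_single_mult mult_1)
  ultimately show "weighted_sum ?f (?U * q) = weighted_sum (in_degree k socle_functional) q"
    by (simp only:)
qed

lemma mdeg_xy: "mdeg m = Poly_Mapping.lookup m X1 + Poly_Mapping.lookup m X2 + (\<Sum>j\<in>UNIV. y_exp m j)"
  by (simp add: mdeg_def sum_xy_var y_exp_def)

text \<open>
  On the monomials of degree 2 in \<open>x1\<close> and \<open>x2\<close>, the functional is 2 on \<open>x1^2\<close>, \<open>i^2 (-2) = 2\<close> on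
  \<open>x2^2\<close> and 0 on \<open>x1 x2\<close>, which is the pairing with \<open>x1^2 + x2^2\<close>. The factor 2 in the statement is the
  divided power factor of \<open>y_j^2\<close>.
\<close>

lemma dp_coeff_eq_socle_functional:
  "dp_coeff quadric_product m = 2 * in_degree 4 socle_functional m"
proof (cases "y_square m")
  case True
  then obtain k where k: "y_exp m = (\<lambda>i. if i = k then 2 else 0)"
    by (auto simp: y_square_def y_exp_def fun_eq_iff)
  hence y: "y_indicator (Some None) (y_exp m) = 1" by auto
  have deg: "mdeg m = Poly_Mapping.lookup m X1 + Poly_Mapping.lookup m X2 + 2"
    by (simp add: mdeg_xy k)
  show ?thesis
  proof (cases "Poly_Mapping.lookup m X1 + Poly_Mapping.lookup m X2 = 2")
    case a: True
    hence "(Poly_Mapping.lookup m X1 = 2 \<and> Poly_Mapping.lookup m X2 = 0) \<or>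
        (Poly_Mapping.lookup m X1 = 1 \<and> Poly_Mapping.lookup m X2 = 1) \<or>
        (Poly_Mapping.lookup m X1 = 0 \<and> Poly_Mapping.lookup m X2 = 2)" by linarith
    thus ?thesis
      using True y deg by (auto simp: dp_coeff_quadric_product in_degree_def socle_functional_def
          functional_def x_char_def x_deriv_def simp del: y_indicator.simps)
  next
    case False
    thus ?thesis using deg by (auto simp: dp_coeff_quadric_product in_degree_def)
  qed
next
  case False
  hence "y_indicator (Some None) (y_exp m) = 0"
    by (auto simp: y_square_def y_exp_def fun_eq_iff)
  thus ?thesis using False
    by (simp add: dp_coeff_quadric_product in_degree_def socle_functional_def functional_def
        del: y_indicator.simps)
qed

lemma socle_ideal_subset_perp: "graded_apolar_ideal socle_functional \<subseteq> perp quadric_product"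
proof
  fix p :: "'a xy_var mpoly" assume "p \<in> graded_apolar_ideal socle_functional"
  hence "p \<in> apolar_ideal (in_degree 4 socle_functional)"
    by (auto simp: graded_apolar_ideal_def)
  thus "p \<in> perp quadric_product"
    unfolding perp_eq_apolar_ideal apolar_ideal_def
    using weighted_sum_lincomb[of 2 _ 0 "\<lambda>_. 0" p] by (simp add: dp_coeff_eq_socle_functional)
qed

lemma cactus_rank_le:
  "cactus_rank (quadric_product :: 'n::finite xy_var mpoly) \<le> enat (2 * CARD('n) + 4)"
  unfolding cactus_rank_def
proof (intro Inf_lower CollectI exI conjI)
  let ?I = "graded_apolar_ideal (socle_functional :: 'n xy_var monom \<Rightarrow> _)"
  show "zero_dim_subscheme ?I (2 * CARD('n) + 4)"
    unfolding zero_dim_subscheme_def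
    by (intro conjI homogeneous_graded_apolar_ideal saturated_socle_ideal)
      (auto intro!: eventually_sequentiallyI[of 3] hilbert_function_socle_ideal)
  show "?I \<subseteq> perp quadric_product"
    by (rule socle_ideal_subset_perp)
qed simp

section \<open>The lower bound on the border rank\<close>

lemma dp_coeff_smul: "dp_coeff (smul c p) m = c * dp_coeff p m"
  by (simp add: dp_coeff_def lookup_smul algebra_simps)

lemma dp_coeff_sum: "dp_coeff (\<Sum>i\<in>A. p i) m = (\<Sum>i\<in>A. dp_coeff (p i) m)"
  by (simp add: dp_coeff_def lookup_sum sum_distrib_left)

text \<open>
  The value of the monomial \<open>m\<close> at the vector of coefficients of the linear form \<open>L\<close>.
\<close>

definition coeff_power :: "'v::finite mpoly \<Rightarrow> 'v monom \<Rightarrow> complex" where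
  "coeff_power L m = (\<Prod>v\<in>UNIV. Poly_Mapping.lookup L (Poly_Mapping.single v 1) ^ Poly_Mapping.lookup m v)"

lemma coeff_power_add: "coeff_power L (m + m') = coeff_power L m * coeff_power L m'"
  by (simp add: coeff_power_def lookup_add power_add prod.distrib)

lemma coeff_power_single: "coeff_power L (Poly_Mapping.single v 1) = Poly_Mapping.lookup L (Poly_Mapping.single v 1)"
proof -
  have "coeff_power L (Poly_Mapping.single v 1) =
      (\<Prod>w\<in>UNIV. if w = v then Poly_Mapping.lookup L (Poly_Mapping.single v 1) else 1)"
    unfolding coeff_power_def by (intro prod.cong) (auto simp: lookup_single when_def)
  thus ?thesis by simp
qed

lemma mdeg_eq_1: "mdeg (m :: 'v::finite monom) = 1 \<Longrightarrow> \<exists>v. m = Poly_Mapping.single v 1"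
proof -
  assume m: "mdeg m = 1"
  then obtain v where v: "Poly_Mapping.lookup m v > 0"
    unfolding mdeg_def by (metis (mono_tags, lifting) not_gr_zero sum.neutral zero_neq_one)
  have *: "m = (m - Poly_Mapping.single v 1) + Poly_Mapping.single v 1"
    using v by (intro monom_diff_add_single[symmetric]) simp
  have "mdeg m = mdeg (m - Poly_Mapping.single v 1) + 1"
    by (subst *) (simp only: mdeg_add mdeg_single)
  hence "mdeg (m - Poly_Mapping.single v 1) = 0" using m by simp
  hence "m - Poly_Mapping.single v 1 = 0"
    by (intro poly_mapping_eqI) (simp add: mdeg_def)
  thus ?thesis using * by (metis add_0)
qed

lemma linear_form_expand:
  fixes L :: "'v::finite mpoly"
  assumes "is_form 1 L"
  shows "L = (\<Sum>v\<in>UNIV. smul (Poly_Mapping.lookup L (Poly_Mapping.single v 1)) (Var v))"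
proof (rule poly_mapping_eqI)
  fix m :: "'v monom"
  have R: "Poly_Mapping.lookup (\<Sum>v\<in>UNIV. smul (Poly_Mapping.lookup L (Poly_Mapping.single v 1)) (Var v)) m =
      (\<Sum>v\<in>UNIV. if Poly_Mapping.single v 1 = m then Poly_Mapping.lookup L m else 0)"
    by (auto simp: lookup_sum lookup_smul Var_def lookup_single when_def intro!: sum.cong)
  show "Poly_Mapping.lookup L m =
      Poly_Mapping.lookup (\<Sum>v\<in>UNIV. smul (Poly_Mapping.lookup L (Poly_Mapping.single v 1)) (Var v)) m"
  proof (cases "mdeg m = 1")
    case True
    then obtain w where w: "m = Poly_Mapping.single w 1" using mdeg_eq_1 by blast
    have "Poly_Mapping.single v (1::nat) = Poly_Mapping.single w 1 \<longleftrightarrow> v = w" for v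
      by (metis lookup_single_eq lookup_single_not_eq zero_neq_one)
    thus ?thesis unfolding R by (simp add: w)
  next
    case False
    hence "Poly_Mapping.lookup L m = 0"
      using assms by (auto simp: is_form_def in_keys_iff)
    thus ?thesis unfolding R by (simp cong: if_cong)
  qed
qed

lemma lookup_Var_mult:
  "Poly_Mapping.lookup (Var v * p) m =
    (if Poly_Mapping.lookup m v = 0 then 0 else Poly_Mapping.lookup p (m - Poly_Mapping.single v 1))"
proof -
  have w: "Poly_Mapping.lookup q m = weighted_sum (\<lambda>a. if a = m then 1 else 0) q" for q :: "'a mpoly"
    by (auto simp: weighted_sum_def if_distrib[of "\<lambda>x. x * _"] in_keys_iff cong: if_cong)
  have *: "Poly_Mapping.lookup (Var v * p) m = weighted_sum (\<lambda>a. if Poly_Mapping.single v 1 + a = m then 1 else 0) p"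
    unfolding w Var_def weighted_sum_single_mult by simp
  show ?thesis
  proof (cases "Poly_Mapping.lookup m v = 0")
    case True
    hence "Poly_Mapping.single v 1 + a \<noteq> m" for a
      by (auto simp: lookup_add)
    thus ?thesis unfolding * using True by (simp add: weighted_sum_def)
  next
    case False
    have "m = Poly_Mapping.single v 1 + (m - Poly_Mapping.single v 1)"
      using False monom_diff_add_single[of 1 m v] by (simp add: add.commute)
    hence "Poly_Mapping.single v 1 + a = m \<longleftrightarrow> a = m - Poly_Mapping.single v 1" for a
      by (metis add_left_imp_eq)
    hence "Poly_Mapping.lookup (Var v * p) m = weighted_sum (\<lambda>a. if a = m - Poly_Mapping.single v 1 then 1 else 0) p"
      unfolding * by (simp only:)
    also have "\<dots> = Poly_Mapping.lookup p (m - Poly_Mapping.single v 1)"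
      by (auto simp: weighted_sum_def if_distrib[of "\<lambda>x. x * _"] in_keys_iff cong: if_cong)
    finally show ?thesis using False by simp
  qed
qed

lemma dp_coeff_Var_mult:
  "dp_coeff (Var v * p) m = of_nat (Poly_Mapping.lookup m v) * dp_coeff p (m - Poly_Mapping.single v 1)"
proof (cases "Poly_Mapping.lookup m v = 0")
  case True
  thus ?thesis by (simp add: dp_coeff_def lookup_Var_mult)
next
  case False
  let ?m' = "m - Poly_Mapping.single v 1"
  have "m = ?m' + Poly_Mapping.single v 1"
    using False by (intro monom_diff_add_single[symmetric]) simp
  hence "mfact m = of_nat (Poly_Mapping.lookup ?m' v + 1) * mfact ?m'"
    using mfact_add_single by metis
  also have "Poly_Mapping.lookup ?m' v + 1 = Poly_Mapping.lookup m v"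
    using False by (simp add: lookup_minus)
  finally show ?thesis using False by (simp add: dp_coeff_def lookup_Var_mult)
qed

text \<open>
  The multinomial theorem in divided powers. The induction multiplies by one more factor \<open>L\<close> and uses that
  the exponents of \<open>m\<close> add up to its degree.
\<close>

lemma dp_coeff_linear_power:
  fixes L :: "'v::finite mpoly"
  assumes L: "is_form 1 L" and "mdeg m = d"
  shows "dp_coeff (L ^ d) m = fact d * coeff_power L m"
  using assms(2)
proof (induction d arbitrary: m)
  case 0
  hence "m = 0"
    by (intro poly_mapping_eqI) (simp add: mdeg_def)
  thus ?case by (simp add: dp_coeff_def mfact_def coeff_power_def lookup_one)
next
  case (Suc d)
  let ?l = "\<lambda>v. Poly_Mapping.lookup L (Poly_Mapping.single v 1)"
  have summand: "?l v * (of_nat (Poly_Mapping.lookup m v) * dp_coeff (L ^ d) (m - Poly_Mapping.single v 1)) =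
      of_nat (Poly_Mapping.lookup m v) * (fact d * coeff_power L m)" for v
  proof (cases "Poly_Mapping.lookup m v = 0")
    case False
    let ?m' = "m - Poly_Mapping.single v 1"
    have m: "m = ?m' + Poly_Mapping.single v 1"
      using False by (intro monom_diff_add_single[symmetric]) simp
    have "mdeg m = mdeg ?m' + 1"
      by (subst m) (simp only: mdeg_add mdeg_single)
    hence "mdeg ?m' = d" using Suc.prems by simp
    hence IH: "dp_coeff (L ^ d) ?m' = fact d * coeff_power L ?m'"
      by (rule Suc.IH)
    have "coeff_power L m = coeff_power L ?m' * ?l v"
      by (subst m) (simp only: coeff_power_add coeff_power_single)
    thus ?thesis unfolding IH by simp
  qed simp
  have "dp_coeff (L ^ Suc d) m = dp_coeff ((\<Sum>v\<in>UNIV. smul (?l v) (Var v)) * L ^ d) m"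
    using linear_form_expand[OF L] by simp
  also have "\<dots> = (\<Sum>v\<in>UNIV. ?l v * (of_nat (Poly_Mapping.lookup m v) * dp_coeff (L ^ d) (m - Poly_Mapping.single v 1)))"
    by (simp only: sum_distrib_right smul_mult dp_coeff_sum dp_coeff_smul dp_coeff_Var_mult)
  also have "\<dots> = of_nat (mdeg m) * (fact d * coeff_power L m)"
    unfolding summand by (simp add: mdeg_def sum_distrib_right)
  finally show ?case using Suc.prems by (simp add: algebra_simps)
qed

text \<open>
  The rows lie in the span of \<open>r\<close> vectors, so they cannot span the whole space.
\<close>

lemma det_eq_0_if_low_rank:
  fixes A :: "complex ^ 'i ^ 'i" and b :: "nat \<Rightarrow> complex ^ 'i"
  assumes A: "\<And>i. A $ i = (\<Sum>k<r. c i k *s b k)" and r: "r < CARD('i)"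
  shows "det A = 0"
proof (rule ccontr)
  assume "det A \<noteq> 0"
  hence "invertible A" by (simp add: invertible_det_nz)
  hence "vec.span (rows A) = UNIV"
    using matrix_left_invertible_span_rows_gen[of A] invertible_left_inverse[of A] by blast
  moreover have "A $ i \<in> vec.span (b ` {..<r})" for i
    unfolding A by (intro vec.span_sum vec.span_scale vec.span_base) auto
  hence "rows A \<subseteq> vec.span (b ` {..<r})"
    by (auto simp: rows_def row_def vec_nth_inverse)
  ultimately have "(UNIV :: (complex ^ 'i) set) \<subseteq> vec.span (b ` {..<r})"
    using vec.span_minimal[OF _ vec.subspace_span] by metis
  hence "vec.dim (UNIV :: (complex ^ 'i) set) \<le> card (b ` {..<r})"
    by (intro vec.dim_le_card) auto
  also have "\<dots> \<le> r" using card_image_le[of "{..<r}" b] by simp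
  finally show False using r vec.dim_UNIV by (simp add: vec.dimension_def card_cart_basis)
qed

lemma tendsto_det:
  fixes A :: "nat \<Rightarrow> complex ^ 'i ^ 'i"
  assumes "\<And>i j. (\<lambda>k. A k $ i $ j) \<longlonglongrightarrow> B $ i $ j"
  shows "(\<lambda>k. det (A k)) \<longlonglongrightarrow> det B"
  unfolding det_def by (intro tendsto_intros assms)

lemma waring_rank_decomposition:
  assumes "waring_rank d G = enat r"
  obtains \<alpha> L where "\<And>i. i < r \<Longrightarrow> is_form 1 (L i)" "G = (\<Sum>i<r. smul (\<alpha> i) (L i ^ d))"
proof -
  let ?S = "{enat r | r. \<exists>\<alpha> L. (\<forall>i<r. is_form 1 (L i)) \<and> G = (\<Sum>i<r. smul (\<alpha> i) (L i ^ d))}"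
  have ne: "?S \<noteq> {}"
  proof
    assume "?S = {}"
    hence "waring_rank d G = \<infinity>"
      unfolding waring_rank_def by (simp only: Inf_enat_def) simp
    thus False using assms by simp
  qed
  have Inf_in: "Inf S \<in> S" if "S \<noteq> {}" for S :: "enat set"
    using that by (auto simp: Inf_enat_def intro: LeastI)
  have "enat r \<in> ?S"
    using Inf_in[OF ne] unfolding assms[unfolded waring_rank_def] .
  hence "\<exists>\<alpha> L. (\<forall>i<r. is_form 1 (L i)) \<and> G = (\<Sum>i<r. smul (\<alpha> i) (L i ^ d))"
    by (simp only: mem_Collect_eq enat.inject) blast
  then obtain \<alpha> L where "\<forall>i<r. is_form 1 (L i)" "G = (\<Sum>i<r. smul (\<alpha> i) (L i ^ d))"
    by (elim exE conjE)
  thus ?thesis by (intro that) auto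
qed

text \<open>
  A monomial basis of the quadratic operators modulo those apolar to the form: \<open>x1 y_j\<close>, \<open>x2 y_j\<close>, \<open>x1^2\<close>
  and \<open>y_k^2\<close>, where \<open>k\<close> is a fixed index. There are \<open>2 n + 2\<close> of them.
\<close>

definition quadric_monom :: "'n \<Rightarrow> bool \<times> 'n option \<Rightarrow> 'n xy_var monom" where
  "quadric_monom k = (\<lambda>(s, t). case t of
     None \<Rightarrow> Poly_Mapping.single (if s then X1 else Y k) 2
   | Some j \<Rightarrow> Poly_Mapping.single (if s then X1 else X2) 1 + Poly_Mapping.single (Y j) 1)"

lemma mdeg_quadric_monom: "mdeg (quadric_monom k i) = 2"
  by (cases i) (auto simp: quadric_monom_def mdeg_add mdeg_single split: option.splits)

definition catalecticant :: "'n::finite \<Rightarrow> 'n xy_var mpoly \<Rightarrow> complex ^ (bool \<times> 'n option) ^ (bool \<times> 'n option)" where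
  "catalecticant k G = (\<chi> i j. dp_coeff G (quadric_monom k i + quadric_monom k j))"

text \<open>
  By \<open>dp_coeff_linear_power\<close>, a fourth power \<open>L^4\<close> contributes 24 times the rank one matrix of products
  of values of the monomials at \<open>L\<close>.
\<close>

lemma det_catalecticant_eq_0:
  fixes k :: "'n::finite"
  assumes G: "waring_rank 4 G = enat r" and r: "r < 2 * CARD('n) + 2"
  shows "det (catalecticant k G) = 0"
proof -
  obtain \<alpha> L where L: "\<And>i. i < r \<Longrightarrow> is_form 1 (L i)" "G = (\<Sum>i<r. smul (\<alpha> i) (L i ^ 4))"
    using waring_rank_decomposition[OF G] by blast
  show ?thesis
  proof (rule det_eq_0_if_low_rank)
    fix i
    show "catalecticant k G $ i =
        (\<Sum>l<r. (24 * \<alpha> l * coeff_power (L l) (quadric_monom k i)) *s (\<chi> j. coeff_power (L l) (quadric_monom k j)))"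
    proof (rule vec_eq_iff[THEN iffD2, rule_format])
      fix j
      have "dp_coeff G (quadric_monom k i + quadric_monom k j) =
          (\<Sum>l<r. \<alpha> l * dp_coeff (L l ^ 4) (quadric_monom k i + quadric_monom k j))"
        unfolding L(2) by (simp add: dp_coeff_sum dp_coeff_smul)
      also have "\<dots> = (\<Sum>l<r. \<alpha> l * (fact 4 * coeff_power (L l) (quadric_monom k i + quadric_monom k j)))"
        by (intro sum.cong refl arg_cong2[where f = "(*)"] dp_coeff_linear_power L(1))
          (simp_all add: mdeg_add mdeg_quadric_monom)
      finally show "catalecticant k G $ i $ j =
        (\<Sum>l<r. (24 * \<alpha> l * coeff_power (L l) (quadric_monom k i)) *s (\<chi> j. coeff_power (L l) (quadric_monom k j))) $ j"
        by (simp add: catalecticant_def coeff_power_add fact_numeral algebra_simps)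
    qed
  next
    show "r < CARD(bool \<times> 'n option)" using r by (simp add: card_option)
  qed
qed

text \<open>
  The monomials \<open>x1^2\<close> and \<open>y_k^2\<close> pair with each other, the monomials \<open>x1 y_j\<close> and \<open>x2 y_j\<close> with themselves.
\<close>

lemma catalecticant_quadric_product:
  fixes k :: "'n::finite"
  defines "\<sigma> \<equiv> \<lambda>(s, t). (if t = None then \<not> s else s, t :: 'n option)"
  shows "catalecticant k quadric_product $ i $ j = (if j = \<sigma> i then 4 else 0)"
proof -
  have *: "y_square (Poly_Mapping.single a 1 + Poly_Mapping.single (Y l) 1 +
      (Poly_Mapping.single b 1 + Poly_Mapping.single (Y l') 1)) \<longleftrightarrow> l = l'"
    if "a \<in> {X1, X2}" "b \<in> {X1, X2}" for a b and l l' :: 'n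
  proof (cases "l = l'")
    case True
    thus ?thesis using that by (auto simp: y_square_def lookup_add lookup_single when_def intro!: exI[of _ l])
  next
    case False
    thus ?thesis using not_y_square_add[OF False, of "Poly_Mapping.single a 1 + Poly_Mapping.single b 1"]
      by (simp add: ac_simps)
  qed
  have y2: "y_square (Poly_Mapping.single (Y k) 2 + Poly_Mapping.single X1 2)"
    "y_square (Poly_Mapping.single X1 2 + Poly_Mapping.single (Y k) 2)"
    by (auto simp: y_square_def lookup_add lookup_single when_def intro!: exI[of _ k])
  obtain s t s' t' where ij: "i = (s, t)" "j = (s', t')" by (cases i; cases j)
  show ?thesis
  proof (cases t)
    case None
    note t = None
    show ?thesis
    proof (cases t')
      case None
      show ?thesis
        unfolding ij t None \<sigma>_def catalecticant_def dp_coeff_quadric_product quadric_monom_def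
        by (cases s; cases s') (simp_all add: y2 lookup_add lookup_single)
    next
      case (Some l')
      show ?thesis
        unfolding ij t Some \<sigma>_def catalecticant_def dp_coeff_quadric_product quadric_monom_def
        by (cases s; cases s') (simp_all add: lookup_add lookup_single)
    qed
  next
    case (Some l)
    note t = Some
    show ?thesis
    proof (cases t')
      case None
      show ?thesis
        unfolding ij t None \<sigma>_def catalecticant_def dp_coeff_quadric_product quadric_monom_def
        by (cases s; cases s') (simp_all add: lookup_add lookup_single)
    next
      case (Some l')
      have sq: "y_square (quadric_monom k i + quadric_monom k j) \<longleftrightarrow> l = l'"
        unfolding ij t Some quadric_monom_def case_prod_conv option.case by (rule *) auto
      show ?thesis
        unfolding catalecticant_def dp_coeff_quadric_product vec_lambda_beta sq
        unfolding ij t Some \<sigma>_def quadric_monom_def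
        by (cases s; cases s') (auto simp: lookup_add lookup_single)
    qed
  qed
qed

lemma det_catalecticant_quadric_product:
  fixes k :: "'n::finite"
  shows "det (catalecticant k quadric_product) \<noteq> 0"
proof -
  define \<sigma> where "\<sigma> = (\<lambda>(s, t). (if t = None then \<not> s else s, t :: 'n option))"
  let ?M = "catalecticant k quadric_product"
  have M: "?M $ i $ j = (if j = \<sigma> i then 4 else 0)" for i j
    unfolding \<sigma>_def by (rule catalecticant_quadric_product)
  \<comment> \<open>The matrix is 4 times the permutation matrix of the involution \<open>\<sigma>\<close>, so its square is 16.\<close>
  let ?N = "(\<chi> i j. ?M $ i $ j / 16) :: complex ^ (bool \<times> 'n option) ^ (bool \<times> 'n option)"
  have \<sigma>: "\<sigma> (\<sigma> i) = i" for i by (cases i) (auto simp: \<sigma>_def)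
  have "(?M ** ?N) $ i $ j = mat 1 $ i $ j" for i j
  proof -
    have "(?M ** ?N) $ i $ j = (\<Sum>l\<in>UNIV. if l = \<sigma> i then 4 * ?N $ l $ j else 0)"
      unfolding matrix_matrix_mult_def vec_lambda_beta M by (intro sum.cong) auto
    also have "\<dots> = (if j = i then 1 else 0)"
      by (simp add: M \<sigma>)
    finally show ?thesis by (simp add: mat_def eq_commute)
  qed
  hence "?M ** ?N = mat 1"
    by (simp add: vec_eq_iff)
  hence "invertible ?M"
    by (metis invertible_right_inverse)
  thus ?thesis by (simp add: invertible_det_nz)
qed

lemma border_rank_ge:
  "enat (2 * CARD('n) + 2) \<le> border_rank 4 (quadric_product :: 'n::finite xy_var mpoly)"
  unfolding border_rank_def
proof (rule Inf_greatest, safe)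
  fix r and G :: "nat \<Rightarrow> 'n xy_var mpoly"
  assume G: "\<forall>k. is_form 4 (G k) \<and> waring_rank 4 (G k) = enat r" "form_tendsto G quadric_product"
  fix k :: 'n
  show "enat (2 * CARD('n) + 2) \<le> enat r"
  proof (rule ccontr)
    assume "\<not> ?thesis"
    hence "det (catalecticant k (G l)) = 0" for l
      using G(1) by (intro det_catalecticant_eq_0[of _ r]) auto
    moreover have "(\<lambda>l. det (catalecticant k (G l))) \<longlonglongrightarrow> det (catalecticant k quadric_product)"
    proof (rule tendsto_det)
      fix i j
      show "(\<lambda>l. catalecticant k (G l) $ i $ j) \<longlonglongrightarrow> catalecticant k quadric_product $ i $ j"
        using G(2) unfolding catalecticant_def dp_coeff_def form_tendsto_def
        by (auto intro!: tendsto_intros)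
    qed
    ultimately have "det (catalecticant k quadric_product) = 0"
      by (simp add: LIMSEQ_const_iff)
    thus False using det_catalecticant_quadric_product by blast
  qed
qed

section \<open>The upper bound on the border rank\<close>

lemma waring_rank_le:
  assumes "finite J" "\<And>j. j \<in> J \<Longrightarrow> is_form 1 (L j)" "G = (\<Sum>j\<in>J. smul (\<alpha> j) (L j ^ d))"
  shows "waring_rank d G \<le> enat (card J)"
proof -
  obtain h where h: "bij_betw h {..<card J} J"
    using ex_bij_betw_nat_finite[OF assms(1)] by (auto simp: atLeast0LessThan)
  show ?thesis
    unfolding waring_rank_def
  proof (intro Inf_lower CollectI exI conjI)
    show "G = (\<Sum>i<card J. smul (\<alpha> (h i)) (L (h i) ^ d))"
      unfolding assms(3) using sum.reindex_bij_betw[OF h] by (rule sym)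
    show "\<forall>i<card J. is_form 1 (L (h i))"
      using assms(2) bij_betwE[OF h] by auto
  qed simp
qed

text \<open>
  Border rank asks for a sequence of constant Waring rank. A sequence of bounded Waring rank has such a
  subsequence by the pigeonhole principle.
\<close>

lemma border_rank_le:
  assumes form: "\<And>k. is_form d (G k)" and rank: "\<And>k. waring_rank d (G k) \<le> enat r" and lim: "form_tendsto G F"
  shows "border_rank d F \<le> enat r"
proof -
  have "\<exists>x\<in>enat ` {..r}. infinite {k. waring_rank d (G k) = x}"
  proof (rule ccontr)
    assume "\<not> ?thesis"
    hence "finite (\<Union>x\<in>enat ` {..r}. {k. waring_rank d (G k) = x})" by auto
    moreover have "(\<Union>x\<in>enat ` {..r}. {k. waring_rank d (G k) = x}) = UNIV"
    proof -
      have "waring_rank d (G k) \<in> enat ` {..r}" for k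
        using rank[of k] by (cases "waring_rank d (G k)") auto
      thus ?thesis by blast
    qed
    ultimately have "finite (UNIV :: nat set)" by (simp only:)
    thus False by simp
  qed
  then obtain s where s: "s \<le> r" "infinite {k. waring_rank d (G k) = enat s}" by auto
  define h where "h = enumerate {k. waring_rank d (G k) = enat s}"
  have h: "waring_rank d (G (h k)) = enat s" for k
    using enumerate_in_set[OF s(2), of k] by (simp add: h_def)
  have "strict_mono h"
    unfolding h_def by (rule strict_mono_enumerate[OF s(2)])
  hence "form_tendsto (\<lambda>k. G (h k)) F"
    using lim LIMSEQ_subseq_LIMSEQ[of "\<lambda>k. Poly_Mapping.lookup (G k) _" _ h]
    unfolding form_tendsto_def by (simp add: o_def)
  hence "border_rank d F \<le> enat s"
    unfolding border_rank_def using h form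
    by (intro Inf_lower CollectI exI[of _ s] exI[of _ "\<lambda>k. G (h k)"] conjI) auto
  also have "\<dots> \<le> enat r" using s(1) by simp
  finally show ?thesis .
qed

definition u_form :: "'n xy_var mpoly" where "u_form = Var X1 + smul \<i> (Var X2)"
definition v_form :: "'n xy_var mpoly" where "v_form = Var X1 - smul \<i> (Var X2)"

lemma uv_eq: "u_form * v_form = Var X1 ^ 2 + Var X2 ^ 2"
  by (simp add: u_form_def v_form_def algebra_simps smul_mult power2_eq_square)

text \<open>
  Here \<open>H w\<close> is \<open>t^3\<close> times the combination of \<open>n + 2\<close> fourth powers that tends to \<open>6 w^2 p 2\<close>, with
  denominators cleared so that the identity holds in any commutative ring.
\<close>

lemma smoothing_identity:
  fixes u v t S n :: "'a::comm_ring_1" and y :: "'i \<Rightarrow> 'a"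
  assumes n: "n = of_nat (card J)" and S: "S = (\<Sum>j\<in>J. y j)"
  defines "p k \<equiv> (\<Sum>j\<in>J. y j ^ k)"
  defines "H w \<equiv> (\<Sum>j\<in>J. t * (w + t * y j) ^ 4) - (w + t ^ 2 * S) ^ 4 + (1 - n * t) * w ^ 4"
  shows "H (u + t * v) - H u = t ^ 4 * (12 * u * v * p 2 +
    t * (6 * v ^ 2 * p 2 + 4 * v * p 3 - 12 * u * v * S ^ 2
      - 6 * t * v ^ 2 * S ^ 2 - 4 * t ^ 2 * v * S ^ 3))"
proof -
  have H: "H w = 6 * w ^ 2 * t ^ 3 * p 2 + 4 * w * t ^ 4 * p 3 + t ^ 5 * p 4
      - 6 * w ^ 2 * t ^ 4 * S ^ 2 - 4 * w * t ^ 6 * S ^ 3 - t ^ 8 * S ^ 4" for w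
  proof -
    have "(\<Sum>j\<in>J. t * (w + t * y j) ^ 4) = (\<Sum>j\<in>J. t * w ^ 4 + 4 * w ^ 3 * t ^ 2 * y j
        + 6 * w ^ 2 * t ^ 3 * y j ^ 2 + 4 * w * t ^ 4 * y j ^ 3 + t ^ 5 * y j ^ 4)"
      by (intro sum.cong refl) (simp add: eval_nat_numeral algebra_simps)
    also have "\<dots> = n * t * w ^ 4 + 4 * w ^ 3 * t ^ 2 * S
        + 6 * w ^ 2 * t ^ 3 * p 2 + 4 * w * t ^ 4 * p 3 + t ^ 5 * p 4"
      by (simp add: sum.distrib sum_distrib_left[symmetric] n S p_def mult.assoc)
    finally show ?thesis
      unfolding H_def by (simp add: eval_nat_numeral algebra_simps)
  qed
  show ?thesis
    unfolding H by (simp add: eval_nat_numeral algebra_simps)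
qed

definition y_sum :: "nat \<Rightarrow> 'n::finite xy_var mpoly" where
  "y_sum k = (\<Sum>j\<in>UNIV. Var (Y j) ^ k)"

text \<open>
  The Boolean index says whether the base point is moved along \<open>v\<close>, the other index selects the point of the
  second difference scheme; it is of the type used for the scheme of the cactus rank, which these
  points smooth.
\<close>

definition smoothing_form :: "complex \<Rightarrow> bool \<times> 'n option option \<Rightarrow> 'n::finite xy_var mpoly" where
  "smoothing_form t = (\<lambda>(s, a). (if s then u_form + smul t v_form else u_form) +
     (case a of None \<Rightarrow> 0 | Some None \<Rightarrow> smul (t ^ 2) (y_sum 1) | Some (Some j) \<Rightarrow> smul t (Var (Y j))))"

definition smoothing_coeff :: "complex \<Rightarrow> bool \<times> 'n::finite option option \<Rightarrow> complex" where
  "smoothing_coeff t = (\<lambda>(s, a). (if s then 1 else - 1) / (12 * t ^ 4) *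
     (case a of None \<Rightarrow> 1 - of_nat CARD('n) * t | Some None \<Rightarrow> - 1 | Some (Some j) \<Rightarrow> t))"

definition smoothing :: "complex \<Rightarrow> 'n::finite xy_var mpoly" where
  "smoothing t = (\<Sum>i\<in>UNIV. smul (smoothing_coeff t i) (smoothing_form t i ^ 4))"

lemma is_form_smoothing_form: "is_form 1 (smoothing_form t i)"
proof -
  have "is_form 1 (u_form :: 'a xy_var mpoly)" "is_form 1 (v_form :: 'a xy_var mpoly)"
    unfolding u_form_def v_form_def
    by (intro is_form_add is_form_diff is_form_smul is_form_Var)+
  moreover have "is_form 1 (y_sum 1 :: 'a xy_var mpoly)"
    by (auto simp: y_sum_def intro!: is_form_sum is_form_Var[simplified])
  ultimately show ?thesis
    using is_form_Var
    by (auto simp: smoothing_form_def split: prod.splits option.splits intro!: is_form_add is_form_smul)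
qed

lemma UNIV_option_eq: "(UNIV :: 'a option set) = insert None (range Some)"
  by (auto intro: option.exhaust)

lemma sum_option: "(\<Sum>x\<in>(UNIV :: 'a::finite option set). f x) = f None + (\<Sum>x\<in>UNIV. f (Some x))"
  unfolding UNIV_option_eq by (simp add: sum.reindex image_iff)

text \<open>
  The curve of forms differs from its limit by \<open>t\<close> times a form with coefficients polynomial in \<open>t\<close>. The
  proof embeds the scalars in the polynomial ring by \<open>c\<close>, in order to apply the ring identity
  \<open>smoothing_identity\<close>, and then cancels \<open>t^4\<close>.
\<close>

lemma smoothing_eq:
  fixes F :: "'n::finite xy_var mpoly"
  assumes t: "t \<noteq> 0"
  defines "u \<equiv> u_form :: 'n xy_var mpoly" and "v \<equiv> v_form :: 'n xy_var mpoly" and "S \<equiv> y_sum 1 :: 'n xy_var mpoly"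
  shows "smoothing t = quadric_product + smul (1 / 12 * t) (6 * v ^ 2 * y_sum 2 + 4 * v * y_sum 3
      - 12 * u * v * S ^ 2 - 6 * smul t (v ^ 2 * S ^ 2) - 4 * smul (t ^ 2) (v * S ^ 3))"
proof -
  define c :: "complex \<Rightarrow> 'n xy_var mpoly" where "c x = Poly_Mapping.single 0 x" for x
  have c: "smul x p = c x * p" for x and p :: "'n xy_var mpoly"
    by (simp add: c_def smul_def)
  have c_mult: "c (x * y) = c x * c y" for x y
    by (simp add: c_def mult_single)
  have c_1: "c 1 = 1" by (simp add: c_def)
  have c_power: "c (x ^ k) = c x ^ k" for x k
    by (induction k) (simp_all add: c_1 c_mult)
  have c_diff: "c (x - y) = c x - c y" for x y
    by (simp add: c_def single_diff)
  have c_uminus: "c (- x) = - c x" for x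
    by (simp add: c_def single_uminus)
  have c_nat: "c (of_nat k) = of_nat k" for k
    by (induction k) (simp_all add: c_def single_add)
  have c_12: "c 12 = 12" using c_nat[of 12] by simp
  define n where "n = (of_nat CARD('n) :: 'n xy_var mpoly)"
  define H where "H w = (\<Sum>j\<in>UNIV. c t * (w + c t * Var (Y j)) ^ 4) - (w + c t ^ 2 * S) ^ 4 + (1 - n * c t) * w ^ 4"
    for w :: "'n xy_var mpoly"
  have S: "S = (\<Sum>j\<in>UNIV. Var (Y j))" by (simp add: S_def y_sum_def)
  let ?k = "1 / (12 * t ^ 4)"
  have half: "(\<Sum>a\<in>UNIV. smul (smoothing_coeff t (s, a)) (smoothing_form t (s, a) ^ 4)) =
      c ((if s then 1 else - 1) * ?k) * H (if s then u + c t * v else u)" for s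
  proof -
    let ?w = "if s then u + c t * v else u" and ?e = "(if s then 1 else - 1) * ?k"
    have "(\<Sum>a\<in>UNIV. smul (smoothing_coeff t (s, a)) (smoothing_form t (s, a) ^ 4)) =
      c (?e * (1 - of_nat CARD('n) * t)) * ?w ^ 4 + (c (?e * (- 1)) * (?w + c (t ^ 2) * S) ^ 4 +
      (\<Sum>j\<in>UNIV. c (?e * t) * (?w + c t * Var (Y j)) ^ 4))"
      unfolding sum_option smoothing_coeff_def smoothing_form_def c
      by (simp add: u_def v_def S_def)
    also have "\<dots> = c ?e * H ?w"
      unfolding H_def c_mult c_diff c_uminus c_nat c_1 c_power n_def
      by (simp add: sum_distrib_left algebra_simps)
    finally show ?thesis .
  qed
  have "smoothing t = (\<Sum>s\<in>UNIV. \<Sum>a\<in>UNIV. smul (smoothing_coeff t (s, a)) (smoothing_form t (s, a) ^ 4))"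
    by (simp add: smoothing_def sum.cartesian_product)
  also have "\<dots> = c ?k * (H (u + c t * v) - H u)"
    unfolding half by (simp add: UNIV_bool c_uminus algebra_simps)
  also have "H (u + c t * v) - H u = c t ^ 4 * (12 * u * v * y_sum 2 +
      c t * (6 * v ^ 2 * y_sum 2 + 4 * v * y_sum 3 - 12 * u * v * S ^ 2
      - 6 * c t * v ^ 2 * S ^ 2 - 4 * c t ^ 2 * v * S ^ 3))"
    unfolding H_def y_sum_def
    by (rule smoothing_identity[where J = UNIV and y = "\<lambda>j. Var (Y j)", OF n_def S])
  also have "c ?k * \<dots> = (c ?k * c t ^ 4 * 12) * (u * v * y_sum 2) +
      (c ?k * c t ^ 4) * c t * (6 * v ^ 2 * y_sum 2 + 4 * v * y_sum 3 - 12 * u * v * S ^ 2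
      - 6 * c t * v ^ 2 * S ^ 2 - 4 * c t ^ 2 * v * S ^ 3)"
    by (simp only: algebra_simps)
  also have "c ?k * c t ^ 4 = c (1 / 12)"
    unfolding c_power[symmetric] c_mult[symmetric] using t by simp
  also have "c (1 / 12) * 12 = 1"
    unfolding c_12[symmetric] c_mult[symmetric] by (simp add: c_1)
  also have "1 * (u * v * y_sum 2) = quadric_product"
    by (simp add: u_def v_def uv_eq quadric_product_def y_sum_def)
  finally show ?thesis
    unfolding c c_mult c_power by (simp only: mult.assoc mult.left_commute)
qed

lemma border_rank_quadric_product_le:
  "border_rank 4 (quadric_product :: 'n::finite xy_var mpoly) \<le> enat (2 * CARD('n) + 4)"
proof (rule border_rank_le)
  define t :: "nat \<Rightarrow> complex" where "t k = inverse (of_nat (Suc k))" for k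
  have t0: "t k \<noteq> 0" for k by (simp add: t_def del: of_nat_Suc)
  have t: "t \<longlonglongrightarrow> 0"
    unfolding t_def by (rule LIMSEQ_Suc[OF lim_inverse_n])
  show "is_form 4 (smoothing (t k) :: 'n xy_var mpoly)" for k
    using is_form_power[OF is_form_smoothing_form, of 4] unfolding smoothing_def
    by (intro is_form_sum is_form_smul) simp
  show "waring_rank 4 (smoothing (t k) :: 'n xy_var mpoly) \<le> enat (2 * CARD('n) + 4)" for k
  proof -
    have "waring_rank 4 (smoothing (t k) :: 'n xy_var mpoly) \<le> enat (card (UNIV :: (bool \<times> 'n option option) set))"
      by (rule waring_rank_le[where L = "smoothing_form (t k)" and \<alpha> = "smoothing_coeff (t k)"])
        (rule finite is_form_smoothing_form smoothing_def)+
    thus ?thesis by (simp add: card_prod card_option eval_nat_numeral)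
  qed
  show "form_tendsto (\<lambda>k. smoothing (t k)) (quadric_product :: 'n xy_var mpoly)"
    unfolding form_tendsto_def
  proof
    fix m
    define E1 where "E1 = (6 * v_form ^ 2 * y_sum 2 + 4 * v_form * y_sum 3
      - 12 * u_form * v_form * y_sum 1 ^ 2 :: 'n xy_var mpoly)"
    define E2 where "E2 = (v_form ^ 2 * y_sum 1 ^ 2 :: 'n xy_var mpoly)"
    define E3 where "E3 = (v_form * y_sum 1 ^ 3 :: 'n xy_var mpoly)"
    have *: "6 * p = smul 6 p" "4 * p = smul 4 p" for p :: "'n xy_var mpoly"
      by (simp_all add: smul_def)
    let ?l = "\<lambda>p :: 'n xy_var mpoly. Poly_Mapping.lookup p m"
    have "?l (smoothing (t k)) = ?l quadric_product + 1 / 12 * t k *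
        (?l E1 - 6 * (t k * ?l E2) - 4 * (t k ^ 2 * ?l E3))" for k
      unfolding smoothing_eq[OF t0] E1_def[symmetric] E2_def[symmetric] E3_def[symmetric]
      unfolding lookup_add lookup_smul lookup_minus * ..
    moreover have "(\<lambda>k. ?l quadric_product + 1 / 12 * t k *
        (?l E1 - 6 * (t k * ?l E2) - 4 * (t k ^ 2 * ?l E3))) \<longlonglongrightarrow>
      ?l quadric_product + 1 / 12 * 0 * (?l E1 - 6 * (0 * ?l E2) - 4 * (0 ^ 2 * ?l E3))"
      by (intro tendsto_intros t)
    ultimately show "(\<lambda>k. ?l (smoothing (t k))) \<longlonglongrightarrow> ?l quadric_product"
      by simp
  qed
qed

section \<open>Ranks of the product of the two quadrics\<close>

theorem lemma7p3:
  fixes n :: nat and F :: "'n::finite xy_var mpoly"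
  assumes "n \<ge> 2"
    and "CARD('n) = n"
    and "F = (Var X1 ^ 2 + Var X2 ^ 2) * (\<Sum>j\<in>UNIV. Var (Y j) ^ 2)"
  shows "cactus_rank F = enat (2 * n + 4) \<and>
         enat (2 * n + 2) \<le> border_rank 4 F \<and> border_rank 4 F \<le> enat (2 * n + 4)"
proof -
  have "F = quadric_product"
    using assms(3) by (simp add: quadric_product_def)
  moreover have "CARD('n) \<ge> 2"
    using assms(1,2) by simp
  ultimately show ?thesis
    using cactus_rank_ge[where 'n = 'n] cactus_rank_le[where 'n = 'n]
      border_rank_ge[where 'n = 'n] border_rank_quadric_product_le[where 'n = 'n] assms(2)
    by (simp add: order.antisym)
qed

end
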